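(* Let $E\in{\mathbb R}$, let $t\mapsto H_t=H_t^*\in{\mathbb B}({\cal K})$ and $t\mapsto P_t\in{\mathbb B}({\cal K})$ with $P_t\ge0$ be Lipschitz continuous, and let $T^E_t$ solve $$J\,\partial_tT^E_t=\imath\,(H_t+E\,P_t)\,T^E_t,$$ with initial condition $T^E_0$ a $J$-unitary such that $T^E_0-{\bf 1}$ is Fredholm (so that $T^E_t$ is $J$-unitary). Then: (i) if $H_t+EP_t>0$, then $\frac1\imath V(T^E_t)^*\partial_tV(T^E_t)>0$; (ii) if $H_t+EP_t<0$, then $\frac1\imath V(T^E_t)^*\partial_tV(T^E_t)<0$; (iii) if $\partial_ET^E_0=0$, then $\frac1\imath V(T^E_t)^*\partial_EV(T^E_t)\ge0$.
   Context: ${\cal H}$ is a separable complex Hilbert space, ${\cal K}={\cal H}\oplus{\cal H}$, $J=\begin{pmatrix}{\bf 1}&0\\0&-{\bf 1}\end{pmatrix}$. A bounded invertible $T=\begin{pmatrix}a&b\\c&d\end{pmatrix}$ is $J$-unitary if $T^*JT=J$ ($a,d$ are then invertible), and $V(T)=\begin{pmatrix}(a^* )^{-1}&bd^{-1}\\-d^{-1}c&d^{-1}\end{pmatrix}$ is a unitary on ${\cal K}$. *)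

theory Defs
  imports "HOL-Analysis.Analysis" "HOL-Library.Complex_Order"
begin

class complex_vector = real_vector +
  fixes scaleC :: "complex \<Rightarrow> 'a \<Rightarrow> 'a" (infixr \<open>*\<^sub>C\<close> 75)
  assumes scaleC_add_right: "a *\<^sub>C (x + y) = a *\<^sub>C x + a *\<^sub>C y"
    and scaleC_add_left: "(a + b) *\<^sub>C x = a *\<^sub>C x + b *\<^sub>C x"
    and scaleC_scaleC: "a *\<^sub>C (b *\<^sub>C x) = (a * b) *\<^sub>C x"
    and scaleC_one: "1 *\<^sub>C x = x"
    and scaleR_scaleC: "scaleR r x = (complex_of_real r) *\<^sub>C x"

class complex_inner = complex_vector + real_normed_vector +
  fixes cinner :: "'a \<Rightarrow> 'a \<Rightarrow> complex"
  assumes cinner_commute: "cinner x y = cnj (cinner y x)"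
    and cinner_add_left: "cinner (x + y) z = cinner x z + cinner y z"
    and cinner_scaleC_left: "cinner (a *\<^sub>C x) y = cnj a * cinner x y"
    and cinner_ge_zero: "0 \<le> cinner x x"
    and cinner_eq_zero_iff: "cinner x x = 0 \<longleftrightarrow> x = 0"
    and norm_eq_sqrt_cinner: "norm x = sqrt (Re (cinner x x))"

class chilbert_space = complex_inner + complete_space

instantiation prod :: (complex_vector, complex_vector) complex_vector
begin
definition scaleC_prod_def: "a *\<^sub>C x = (a *\<^sub>C fst x, a *\<^sub>C snd x)"
instance
  by standard (auto simp: scaleC_prod_def scaleC_add_right scaleC_add_left
      scaleC_scaleC scaleR_scaleC scaleR_prod_def scaleC_one)
end

instantiation prod :: (complex_inner, complex_inner) complex_inner
begin
definition cinner_prod_def: "cinner x y = cinner (fst x) (fst y) + cinner (snd x) (snd y)"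
instance
proof
  fix x y z :: "'a \<times> 'b" and a :: complex
  show "cinner x y = cnj (cinner y x)"
    by (simp add: cinner_prod_def cinner_commute[of "fst x"] cinner_commute[of "snd x"])
  show "cinner (x + y) z = cinner x z + cinner y z"
    by (simp add: cinner_prod_def cinner_add_left)
  show "cinner (a *\<^sub>C x) y = cnj a * cinner x y"
    by (simp add: cinner_prod_def scaleC_prod_def cinner_scaleC_left distrib_left)
  show "0 \<le> cinner x x"
    by (simp add: cinner_prod_def add_nonneg_nonneg cinner_ge_zero)
  show "cinner x x = 0 \<longleftrightarrow> x = 0"
  proof
    assume h: "cinner x x = 0"
    have a: "0 \<le> cinner (fst x) (fst x)" "0 \<le> cinner (snd x) (snd x)"
      by (simp_all add: cinner_ge_zero)
    have "cinner (fst x) (fst x) = 0 \<and> cinner (snd x) (snd x) = 0"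
      using h a unfolding cinner_prod_def
      by (metis add_nonneg_eq_0_iff)
    then show "x = 0" by (simp add: cinner_eq_zero_iff prod_eq_iff)
    next
    assume "x = 0"
    moreover have "cinner (0::'a) 0 = 0" "cinner (0::'b) 0 = 0"
      by (simp_all only: cinner_eq_zero_iff)
    ultimately show "cinner x x = 0" by (simp add: cinner_prod_def)
  qed
  have r: "\<And>u::'a. Re (cinner u u) = (norm u)\<^sup>2" "\<And>u::'b. Re (cinner u u) = (norm u)\<^sup>2"
  proof -
    fix u :: 'a
    have "0 \<le> Re (cinner u u)" using cinner_ge_zero[of u] by (simp add: less_eq_complex_def)
    then show "Re (cinner u u) = (norm u)\<^sup>2" by (simp add: norm_eq_sqrt_cinner)
  next
    fix u :: 'b
    have "0 \<le> Re (cinner u u)" using cinner_ge_zero[of u] by (simp add: less_eq_complex_def)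
    then show "Re (cinner u u) = (norm u)\<^sup>2" by (simp add: norm_eq_sqrt_cinner)
  qed
  show "norm x = sqrt (Re (cinner x x))"
    by (simp add: norm_prod_def cinner_prod_def r)
qed
end

instance prod :: (chilbert_space, chilbert_space) chilbert_space ..

text \<open>Bounded operators are represented as bounded (real-)linear maps
  (type \<open>'a \<Rightarrow>\<^sub>L 'a\<close>, with the operator norm) which are moreover complex linear.\<close>

definition clinear_op :: "('a::complex_inner \<Rightarrow>\<^sub>L 'a) \<Rightarrow> bool" where
  "clinear_op A \<longleftrightarrow> (\<forall>c x. blinfun_apply A (c *\<^sub>C x) = c *\<^sub>C blinfun_apply A x)"

definition adj :: "('a::complex_inner \<Rightarrow>\<^sub>L 'a) \<Rightarrow> ('a \<Rightarrow>\<^sub>L 'a)" where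
  "adj A = (SOME B. \<forall>x y. cinner (blinfun_apply A x) y = cinner x (blinfun_apply B y))"

definition op_invertible :: "('a::real_normed_vector \<Rightarrow>\<^sub>L 'a) \<Rightarrow> bool" where
  "op_invertible A \<longleftrightarrow> (\<exists>B. B o\<^sub>L A = id_blinfun \<and> A o\<^sub>L B = id_blinfun)"

definition op_inv :: "('a::real_normed_vector \<Rightarrow>\<^sub>L 'a) \<Rightarrow> ('a \<Rightarrow>\<^sub>L 'a)" where
  "op_inv A = (SOME B. B o\<^sub>L A = id_blinfun \<and> A o\<^sub>L B = id_blinfun)"

definition imag_op :: "'a::complex_inner \<Rightarrow>\<^sub>L 'a" where
  "imag_op = Blinfun (\<lambda>x. \<i> *\<^sub>C x)"

definition op_pos :: "('a::complex_inner \<Rightarrow>\<^sub>L 'a) \<Rightarrow> bool" where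
  "op_pos A \<longleftrightarrow> (\<forall>x. x \<noteq> 0 \<longrightarrow> 0 < cinner x (blinfun_apply A x))"

definition op_neg :: "('a::complex_inner \<Rightarrow>\<^sub>L 'a) \<Rightarrow> bool" where
  "op_neg A \<longleftrightarrow> (\<forall>x. x \<noteq> 0 \<longrightarrow> cinner x (blinfun_apply A x) < 0)"

definition op_nonneg :: "('a::complex_inner \<Rightarrow>\<^sub>L 'a) \<Rightarrow> bool" where
  "op_nonneg A \<longleftrightarrow> (\<forall>x. 0 \<le> cinner x (blinfun_apply A x))"

definition cspan :: "'a::complex_vector set \<Rightarrow> 'a set" where
  "cspan S = {x. \<exists>F c. finite F \<and> F \<subseteq> S \<and> x = (\<Sum>s\<in>F. c s *\<^sub>C s)}"

definition fredholm :: "('a::complex_inner \<Rightarrow>\<^sub>L 'a) \<Rightarrow> bool" where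
  "fredholm A \<longleftrightarrow> closed (range (blinfun_apply A))
     \<and> (\<exists>F. finite F \<and> {x. blinfun_apply A x = 0} \<subseteq> cspan F)
     \<and> (\<exists>F. finite F \<and> {y + z |y z. y \<in> range (blinfun_apply A) \<and> z \<in> cspan F} = UNIV)"

definition separable_space :: "'a::metric_space itself \<Rightarrow> bool" where
  "separable_space _ \<longleftrightarrow> (\<exists>D::'a set. countable D \<and> closure D = UNIV)"

definition blk :: "('h::complex_inner \<Rightarrow>\<^sub>L 'h) \<Rightarrow> ('h \<Rightarrow>\<^sub>L 'h) \<Rightarrow> ('h \<Rightarrow>\<^sub>L 'h) \<Rightarrow> ('h \<Rightarrow>\<^sub>L 'h)
    \<Rightarrow> (('h \<times> 'h) \<Rightarrow>\<^sub>L ('h \<times> 'h))" where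
  "blk a b c d = Blinfun (\<lambda>(x, y). (blinfun_apply a x + blinfun_apply b y,
                                     blinfun_apply c x + blinfun_apply d y))"

definition ent11 :: "(('h::complex_inner \<times> 'h) \<Rightarrow>\<^sub>L ('h \<times> 'h)) \<Rightarrow> ('h \<Rightarrow>\<^sub>L 'h)" where
  "ent11 T = Blinfun (\<lambda>x. fst (blinfun_apply T (x, 0)))"
definition ent12 :: "(('h::complex_inner \<times> 'h) \<Rightarrow>\<^sub>L ('h \<times> 'h)) \<Rightarrow> ('h \<Rightarrow>\<^sub>L 'h)" where
  "ent12 T = Blinfun (\<lambda>y. fst (blinfun_apply T (0, y)))"
definition ent21 :: "(('h::complex_inner \<times> 'h) \<Rightarrow>\<^sub>L ('h \<times> 'h)) \<Rightarrow> ('h \<Rightarrow>\<^sub>L 'h)" where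
  "ent21 T = Blinfun (\<lambda>x. snd (blinfun_apply T (x, 0)))"
definition ent22 :: "(('h::complex_inner \<times> 'h) \<Rightarrow>\<^sub>L ('h \<times> 'h)) \<Rightarrow> ('h \<Rightarrow>\<^sub>L 'h)" where
  "ent22 T = Blinfun (\<lambda>y. snd (blinfun_apply T (0, y)))"

definition Jop :: "('h::complex_inner \<times> 'h) \<Rightarrow>\<^sub>L ('h \<times> 'h)" where
  "Jop = blk id_blinfun 0 0 (- id_blinfun)"

definition J_unitary :: "(('h::complex_inner \<times> 'h) \<Rightarrow>\<^sub>L ('h \<times> 'h)) \<Rightarrow> bool" where
  "J_unitary T \<longleftrightarrow> clinear_op T \<and> op_invertible T \<and> adj T o\<^sub>L Jop o\<^sub>L T = Jop"

definition Vmap :: "(('h::complex_inner \<times> 'h) \<Rightarrow>\<^sub>L ('h \<times> 'h)) \<Rightarrow> (('h \<times> 'h) \<Rightarrow>\<^sub>L ('h \<times> 'h))" where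
  "Vmap T = blk (op_inv (adj (ent11 T))) (ent12 T o\<^sub>L op_inv (ent22 T))
               (- (op_inv (ent22 T) o\<^sub>L ent21 T)) (op_inv (ent22 T))"

end

theory Submission
  imports Defs
begin

text \<open>Write \<open>S u = (fst u, snd (T u))\<close> and \<open>R u = (fst (T u), snd u)\<close>. Then \<open>V(T)\<close> is the scattering
  map with \<open>V(T) S = R\<close>. It is isometric because \<open>T\<close> is \<open>J\<close>-unitary. Differentiating \<open>V S = R\<close> along
  any parameter gives \<open>V' = (R' - V S') S\<inverse>\<close>, hence \<open>S\<^sup>* V\<^sup>* V' S = T\<^sup>* J T'\<close>. For the parameter \<open>t\<close> the right
  hand side is \<open>\<i> T\<^sup>* (H + E P) T\<close>, which gives (i) and (ii). For the parameter \<open>E\<close>, variation of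
  constants for \<open>Y = (T^E)\<^sup>* J T^e\<close>, that is \<open>\<partial>\<^sub>t Y = (e - E) (T^E)\<^sup>* \<i> P T^e\<close>, shows that
  \<open>T\<^sup>* J \<partial>\<^sub>E T = \<i> \<integral> T\<^sup>* P T\<close>, which gives (iii).\<close>

subsection \<open>Inner products and real adjoints\<close>

text \<open>Differentiating the entries of \<open>Vmap\<close> would call for derivatives of
  operator inverses. The relation V S = R avoids this: it gives an exact formula for V(s) - V(t)
  that is linear in T(s) - T(t), and the only other factor that varies with s is V(s), which is
  bounded because it is isometric. In addition S is onto with an explicit bounded inverse built from
  V itself, so a statement about the form of S u is a statement about all vectors; the strict
  inequalities survive because T u vanishes only for u = 0. The hypotheses give J-unitarity only at
  time 0 and, for (iii), differentiability in the energy only at time 0. Both have to be carried to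
  time t. For the energy, T^e is written as T^E J Y, where Y solves a linear equation whose right
  hand side carries the factor e - E. To first order in e - E the Y on that right hand side may then
  be frozen at its constant value for e = E.\<close>

instance chilbert_space \<subseteq> banach ..

lemma cinner_add_right: "cinner x (y + z) = cinner x y + cinner x z"
  by (metis cinner_add_left cinner_commute complex_cnj_add)

lemma cinner_scaleC_right: "cinner x (a *\<^sub>C y) = a * cinner x y"
  by (metis cinner_commute cinner_scaleC_left complex_cnj_cnj complex_cnj_mult)

lemma cinner_scaleR_left: "cinner (r *\<^sub>R x) y = r *\<^sub>R cinner x y"
  by (simp add: scaleR_scaleC cinner_scaleC_left scaleR_conv_of_real)

lemma cinner_scaleR_right: "cinner x (r *\<^sub>R y) = r *\<^sub>R cinner x y"
  by (simp add: scaleR_scaleC cinner_scaleC_right scaleR_conv_of_real)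

lemma cinner_minus_left: "cinner (- x) y = - cinner x y"
  using cinner_scaleR_left[of "-1" x y] by simp

lemma cinner_minus_right: "cinner x (- y) = - cinner x y"
  using cinner_scaleR_right[of x "-1" y] by simp

lemma cinner_diff_left: "cinner (x - y) z = cinner x z - cinner y z"
  using cinner_add_left[of x "- y" z] by (simp add: cinner_minus_left)

lemma cinner_diff_right: "cinner x (y - z) = cinner x y - cinner x z"
  using cinner_add_right[of x y "- z"] by (simp add: cinner_minus_right)

lemma cinner_self: "cinner x x = complex_of_real ((norm x)\<^sup>2)"
proof -
  have "0 \<le> cinner x x" by (rule cinner_ge_zero)
  then show ?thesis
    by (simp add: complex_eq_iff less_eq_complex_def norm_eq_sqrt_cinner)
qed

lemma cinner_zero_left [simp]: "cinner 0 x = 0"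
  using cinner_scaleR_left[of 0 0 x] by simp

lemma cinner_zero_right [simp]: "cinner x 0 = 0"
  using cinner_scaleR_right[of x 0 0] by simp

lemma scaleC_minus_one: "(- 1) *\<^sub>C x = - x"
  using scaleR_scaleC[of "-1" x] by simp

lemma scaleC_minus_left: "(- a) *\<^sub>C x = - (a *\<^sub>C x)"
  by (metis mult_minus1 scaleC_minus_one scaleC_scaleC)

lemma scaleC_minus_right: "a *\<^sub>C (- x) = - (a *\<^sub>C x)"
  by (metis mult.commute mult_minus1 scaleC_minus_left scaleC_minus_one scaleC_scaleC)

lemma scaleC_scaleR_commute: "a *\<^sub>C (r *\<^sub>R x) = r *\<^sub>R (a *\<^sub>C x)"
  by (simp add: scaleR_scaleC scaleC_scaleC mult.commute)

lemma norm_scaleC_i: "norm (\<i> *\<^sub>C x) = norm (x :: _ :: complex_inner)"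
  by (simp add: norm_eq_sqrt_cinner cinner_scaleC_left cinner_scaleC_right)

lemma cinner_i_left: "cinner (\<i> *\<^sub>C x) y = - \<i> * cinner x y"
  by (simp add: cinner_scaleC_left)

lemma norm_cinner_le: "norm (cinner x y) \<le> norm x * norm y"
proof (cases "y = 0")
  case False
  \<comment> \<open>\<open>c *\<^sub>C y\<close> is the orthogonal projection of \<open>x\<close>
    onto the line of \<open>y\<close>. The product is conjugate linear in the first argument, hence
    the order \<open>cinner y x\<close>.\<close>
  define c where "c = cinner y x / complex_of_real ((norm y)\<^sup>2)"
  have ny: "(norm y)\<^sup>2 \<noteq> 0" using False by simp
  have xy: "cinner x y = cnj (cinner y x)" by (rule cinner_commute)
  have cn: "cinner y x = c * complex_of_real ((norm y)\<^sup>2)"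
    using ny by (simp add: c_def)
  have "cinner (x - c *\<^sub>C y) (x - c *\<^sub>C y)
      = cinner x x - c * cinner x y - cnj c * cinner y x + cnj c * c * cinner y y"
    by (simp add: cinner_diff_left cinner_diff_right cinner_scaleC_left cinner_scaleC_right
        algebra_simps)
  also have "\<dots> = complex_of_real ((norm x)\<^sup>2) - c * cnj c * complex_of_real ((norm y)\<^sup>2)"
    unfolding xy cn by (simp add: cinner_self algebra_simps)
  also have "\<dots> = complex_of_real ((norm x)\<^sup>2 - (norm c)\<^sup>2 * (norm y)\<^sup>2)"
    by (simp only: complex_norm_square[symmetric] of_real_diff of_real_mult)
  finally have "complex_of_real ((norm (x - c *\<^sub>C y))\<^sup>2)
      = complex_of_real ((norm x)\<^sup>2 - (norm c)\<^sup>2 * (norm y)\<^sup>2)"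
    by (simp only: cinner_self)
  then have "(norm (x - c *\<^sub>C y))\<^sup>2 = (norm x)\<^sup>2 - (norm c)\<^sup>2 * (norm y)\<^sup>2"
    by (simp only: of_real_eq_iff)
  then have "(norm c * norm y)\<^sup>2 \<le> (norm x)\<^sup>2"
    by (simp add: power_mult_distrib) (metis diff_ge_0_iff_ge zero_le_power2)
  then have le: "norm c * norm y \<le> norm x"
    using power2_le_imp_le norm_ge_zero by blast
  have "norm (cinner x y) = norm c * norm y * norm y"
    unfolding xy cn by (simp add: norm_mult power2_eq_square)
  also have "\<dots> \<le> norm x * norm y"
    using le by (intro mult_right_mono) auto
  finally show ?thesis .
qed simp

lemma bounded_bilinear_cinner: "bounded_bilinear (cinner :: 'a::complex_inner \<Rightarrow> 'a \<Rightarrow> complex)"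
  by standard (auto simp: cinner_add_left cinner_add_right cinner_scaleR_left cinner_scaleR_right
      intro!: exI[of _ 1] norm_cinner_le)

lemma bounded_bilinear_Re_cinner:
  "bounded_bilinear (\<lambda>x y. Re (cinner (x :: 'a::complex_inner) y))"
proof -
  have "norm (Re (cinner x y)) \<le> norm x * norm y * 1" for x y :: 'a
    using abs_Re_le_cmod[of "cinner x y"] norm_cinner_le[of x y] by simp
  then show ?thesis
    by unfold_locales (auto simp: cinner_add_left cinner_add_right cinner_scaleR_left
        cinner_scaleR_right intro!: exI[of _ 1])
qed

lemma Re_cinner_commute: "Re (cinner x y) = Re (cinner y x)"
  by (metis cinner_commute cnj.sel(1))

lemma Re_cinner_ext:
  assumes "\<And>x. Re (cinner x u) = Re (cinner x v)"
  shows "u = v"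
proof -
  have "Re (cinner (u - v) (u - v)) = 0"
    using assms[of "u - v"] by (simp add: cinner_diff_right)
  then show ?thesis by (simp add: cinner_self)
qed

section \<open>Riesz representation, real adjoints and complex linearity\<close>

text \<open>The representing vector minimises \<open>Q x x - 2 f x\<close>; minimising sequences are Cauchy by the
  parallelogram identity.\<close>

lemma coercive_form_represents:
  fixes Q :: "'a::banach \<Rightarrow> 'a \<Rightarrow> real"
  assumes bil: "bounded_bilinear Q" and sym: "\<And>x y. Q x y = Q y x"
    and coer: "\<And>x. (norm x)\<^sup>2 \<le> Q x x" and f: "bounded_linear f"
  shows "\<exists>z. \<forall>y. Q z y = f y"
proof -
  interpret Q: bounded_bilinear Q by (rule bil)
  interpret f: bounded_linear f by (rule f)
  define q where "q x = Q x x - 2 * f x" for x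
  obtain K where K: "\<And>x. norm (f x) \<le> norm x * K" using f.bounded by blast
  have below: "- K\<^sup>2 \<le> q x" for x
  proof -
    \<comment> \<open>Completing the square: \<open>q x\<close> is at least
      \<open>(norm x)\<^sup>2 - 2 * K * norm x\<close>.\<close>
    have "0 \<le> (norm x - K)\<^sup>2" by simp
    moreover have "f x \<le> norm x * K" using K[of x] by simp
    ultimately show ?thesis using coer[of x]
      by (simp add: q_def power2_diff mult.commute mult.left_commute)
  qed
  define m where "m = Inf (range q)"
  have bdd: "bdd_below (range q)" using below by (intro bdd_belowI[of _ "- K\<^sup>2"]) auto
  have m_le: "m \<le> q x" for x unfolding m_def using bdd by (simp add: cInf_lower)
  have "\<exists>x. q x < m + 1 / real (Suc n)" for n
  proof -
    have "Inf (range q) < m + 1 / real (Suc n)" by (simp add: m_def)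
    then show ?thesis using cInf_lessD[of "range q"] by blast
  qed
  then obtain X where X: "\<And>n. q (X n) < m + 1 / real (Suc n)" by metis
  have par: "(norm (x - y))\<^sup>2 \<le> 2 * (q x + q y - 2 * m)" for x y
  proof -
    have "q x + q y - 2 * q ((1/2) *\<^sub>R (x + y)) = Q (x - y) (x - y) / 2"
      by (simp add: q_def Q.add_left Q.add_right Q.diff_left Q.diff_right Q.scaleR_left
          Q.scaleR_right f.add f.scaleR sym[of y x] field_simps)
    then show ?thesis using coer[of "x - y"] m_le[of "(1/2) *\<^sub>R (x + y)"] by simp
  qed
  have "Cauchy X"
  proof (rule metric_CauchyI)
    fix e :: real assume e: "0 < e"
    obtain N :: nat where N: "4 / e\<^sup>2 < real N" using reals_Archimedean2 by blast
    have N': "1 / real (Suc n) < e\<^sup>2 / 4" if "n \<ge> N" for n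
    proof -
      have "4 / e\<^sup>2 < real (Suc n)" using N that by simp
      then show ?thesis using e by (simp add: field_simps)
    qed
    have "dist (X a) (X b) < e" if "a \<ge> N" "b \<ge> N" for a b
    proof -
      have "(norm (X a - X b))\<^sup>2 < e\<^sup>2"
        using par[of "X a" "X b"] X[of a] X[of b] N'[OF that(1)] N'[OF that(2)] by argo
      then show ?thesis using e by (simp add: dist_norm power2_less_imp_less)
    qed
    then show "\<exists>M. \<forall>a\<ge>M. \<forall>b\<ge>M. dist (X a) (X b) < e" by blast
  qed
  then obtain z where z: "X \<longlonglongrightarrow> z" using Cauchy_convergent convergent_def by blast
  have "(\<lambda>n. q (X n)) \<longlonglongrightarrow> q z"
    unfolding q_def by (intro tendsto_intros Q.tendsto f.tendsto z)
  moreover have "(\<lambda>n. m + 1 / real (Suc n)) \<longlonglongrightarrow> m + 0"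
    by (intro tendsto_intros LIMSEQ_Suc[OF lim_1_over_n])
  ultimately have qz: "q z \<le> m"
    using X by (metis (no_types, lifting) LIMSEQ_le add.right_neutral less_imp_le)
  have "Q z y = f y" for y
  proof -
    \<comment> \<open>Along \<open>z + r *\<^sub>R y\<close> the functional changes by
      \<open>a * r + b * r\<^sup>2\<close>. The exact minimiser \<open>- a / (2 * b)\<close> is
      undefined for \<open>b = 0\<close>; dividing by \<open>b + 1\<close> still makes the change
      \<open>- r\<^sup>2\<close>, so minimality forces \<open>a = 0\<close>.\<close>
    define a b r where "a = 2 * (Q z y - f y)" and "b = Q y y" and "r = - a / (b + 1)"
    have b: "0 \<le> b" using coer[of y] zero_le_power2[of "norm y"] unfolding b_def by linarith
    have "q (z + r *\<^sub>R y) - q z = a * r + b * r\<^sup>2"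
      by (simp add: q_def a_def b_def Q.add_left Q.add_right Q.scaleR_left Q.scaleR_right
          f.add f.scaleR sym[of y z] algebra_simps power2_eq_square)
    then have "0 \<le> a * r + b * r\<^sup>2" using qz m_le[of "z + r *\<^sub>R y"] by linarith
    also have "a * r + b * r\<^sup>2 = - (a / (b + 1))\<^sup>2"
    proof -
      have a: "a = - r * (b + 1)" using b by (simp add: r_def)
      have "a * r + b * r\<^sup>2 = - r\<^sup>2"
        by (subst a) (simp add: algebra_simps power2_eq_square)
      then show ?thesis by (simp add: r_def)
    qed
    finally have "a / (b + 1) = 0" by simp
    then show ?thesis using b by (simp add: a_def)
  qed
  then show ?thesis by blast
qed

text \<open>Meant for \<open>g\<close> the adjoint of \<open>A\<close> applied to \<open>y\<close>:
  Cauchy-Schwarz bounds the square of its norm by \<open>norm A * norm g * norm y\<close>, and one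
  factor \<open>norm g\<close> cancels. As it speaks of a single vector, it is available before the
  adjoint is known to be an operator.\<close>

lemma norm_le_of_Re_cinner:
  assumes "Re (cinner g g) = Re (cinner (blinfun_apply A g) y)"
  shows "norm g \<le> norm A * norm y"
proof (cases "g = 0")
  case False
  have "(norm g)\<^sup>2 = Re (cinner (blinfun_apply A g) y)"
    using assms by (simp add: cinner_self)
  also have "\<dots> \<le> norm (blinfun_apply A g) * norm y"
    using complex_Re_le_cmod norm_cinner_le order_trans by blast
  also have "\<dots> \<le> norm A * norm g * norm y"
    by (intro mult_right_mono norm_blinfun) auto
  finally have "norm g * norm g \<le> (norm A * norm y) * norm g"
    by (simp add: power2_eq_square mult_ac)
  then show ?thesis using False by (simp add: mult_le_cancel_right)
qed simp

text \<open>The adjoint for the real inner product \<open>Re (cinner x y)\<close>. Unlike \<open>adj\<close>, which is a junk value on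
  operators that are not complex linear, it is a bounded linear map on all of \<open>'a \<Rightarrow>\<^sub>L 'a\<close> and so
  can be differentiated before \<open>T\<close> is known to be complex linear.\<close>

definition radj :: "('a::chilbert_space \<Rightarrow>\<^sub>L 'a) \<Rightarrow> ('a \<Rightarrow>\<^sub>L 'a)" where
  "radj A = (SOME B. \<forall>x y. Re (cinner (blinfun_apply A x) y) = Re (cinner x (blinfun_apply B y)))"

lemma radj_exists:
  fixes A :: "'a::chilbert_space \<Rightarrow>\<^sub>L 'a"
  shows "\<exists>B. \<forall>x y. Re (cinner (blinfun_apply A x) y) = Re (cinner x (blinfun_apply B y))"
proof -
  have "\<exists>z. \<forall>x. Re (cinner z x) = Re (cinner y (blinfun_apply A x))" for y
  proof (rule coercive_form_represents)
    show "bounded_linear (\<lambda>x. Re (cinner y (blinfun_apply A x)))"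
      using bounded_linear_compose[OF bounded_bilinear.bounded_linear_right
          [OF bounded_bilinear_Re_cinner, of y] blinfun.bounded_linear_right[of A]] .
    show "(norm x)\<^sup>2 \<le> Re (cinner x x)" for x :: 'a by (simp add: cinner_self)
  qed (rule bounded_bilinear_Re_cinner Re_cinner_commute)+
  then obtain g where g: "\<And>x y. Re (cinner (g y) x) = Re (cinner y (blinfun_apply A x))"
    by metis
  have g': "Re (cinner x (g y)) = Re (cinner (blinfun_apply A x) y)" for x y
    using g[of y x] by (metis Re_cinner_commute)
  have "bounded_linear g"
  proof (rule bounded_linear_intro)
    show "g (x + y) = g x + g y" for x y
      by (rule Re_cinner_ext) (simp add: cinner_add_right g')
    show "g (r *\<^sub>R x) = r *\<^sub>R g x" for r x
      by (rule Re_cinner_ext) (simp add: cinner_scaleR_right g')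
    show "norm (g y) \<le> norm y * norm A" for y
      using norm_le_of_Re_cinner[of "g y" A y] by (simp add: g' mult.commute)
  qed
  then show ?thesis
    by (intro exI[of _ "Blinfun g"]) (simp add: bounded_linear_Blinfun_apply g')
qed

lemma Re_cinner_radj:
  "Re (cinner (blinfun_apply A x) y) = Re (cinner x (blinfun_apply (radj A) y))"
  using someI_ex[OF radj_exists[of A]] unfolding radj_def by blast

lemma radj_unique:
  assumes "\<And>x y. Re (cinner (blinfun_apply A x) y) = Re (cinner x (blinfun_apply B y))"
  shows "radj A = B"
  by (intro blinfun_eqI Re_cinner_ext) (metis assms Re_cinner_radj)

lemma norm_radj_le: "norm (radj A) \<le> norm A"
  by (rule norm_blinfun_bound) (auto intro!: norm_le_of_Re_cinner simp: Re_cinner_radj)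

lemma bounded_linear_radj: "bounded_linear (radj :: ('a::chilbert_space \<Rightarrow>\<^sub>L 'a) \<Rightarrow> _)"
proof (rule bounded_linear_intro)
  show "radj (A + B) = radj A + radj B" for A B :: "'a \<Rightarrow>\<^sub>L 'a"
    by (rule radj_unique)
      (simp add: blinfun.add_left cinner_add_left cinner_add_right Re_cinner_radj)
  show "radj (r *\<^sub>R A) = r *\<^sub>R radj A" for r and A :: "'a \<Rightarrow>\<^sub>L 'a"
    by (rule radj_unique)
      (simp add: blinfun.scaleR_left cinner_scaleR_left cinner_scaleR_right Re_cinner_radj)
  show "norm (radj A) \<le> norm A * 1" for A :: "'a \<Rightarrow>\<^sub>L 'a"
    by (simp add: norm_radj_le)
qed

lemma radj_compose: "radj (A o\<^sub>L B) = radj B o\<^sub>L radj A"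
  by (rule radj_unique) (simp add: Re_cinner_radj)

lemma Im_cinner: "Im (cinner x y) = Re (cinner (\<i> *\<^sub>C x) y)"
  by (simp add: cinner_i_left)

text \<open>The imaginary part of an inner product is the real part after \<open>\<i>\<close> is
  applied to the first argument, and a complex linear \<open>A\<close> lets \<open>\<i>\<close> pass
  through.\<close>

lemma cinner_radj:
  assumes "clinear_op A"
  shows "cinner (blinfun_apply A x) y = cinner x (blinfun_apply (radj A) y)"
proof -
  have "\<i> *\<^sub>C blinfun_apply A x = blinfun_apply A (\<i> *\<^sub>C x)"
    using assms by (simp add: clinear_op_def)
  then show ?thesis
    by (simp add: complex_eq_iff Im_cinner Re_cinner_radj)
qed

lemma adj_eq_radj:
  assumes "clinear_op A"
  shows "adj A = radj A"
proof -
  have "\<exists>B. \<forall>x y. cinner (blinfun_apply A x) y = cinner x (blinfun_apply B y)"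
    using cinner_radj[OF assms] by blast
  then have "\<forall>x y. cinner (blinfun_apply A x) y = cinner x (blinfun_apply (adj A) y)"
    unfolding adj_def by (rule someI_ex)
  then show ?thesis by (intro radj_unique[symmetric]) simp
qed

text \<open>Polarisation. The order on the complex numbers makes \<open>cinner x (P x)\<close> real;
  expanding at \<open>x + y\<close> gives symmetry of the imaginary parts, and replacing
  \<open>x\<close> by \<open>\<i> *\<^sub>C x\<close> turns this into symmetry of the real
  parts.\<close>

lemma op_nonneg_radj:
  assumes lin: "clinear_op P" and "op_nonneg P"
  shows "radj P = P"
proof -
  have real: "Im (cinner x (blinfun_apply P x)) = 0" for x
    using assms(2) by (auto simp: op_nonneg_def less_eq_complex_def)
  have im: "Im (cinner x (blinfun_apply P y)) = Im (cinner (blinfun_apply P x) y)" for x y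
  proof -
    have "Im (cinner x (blinfun_apply P y)) + Im (cinner y (blinfun_apply P x)) = 0"
      using real[of "x + y"] real[of x] real[of y]
      by (simp add: blinfun.add_right cinner_add_left cinner_add_right)
    moreover have "Im (cinner y (blinfun_apply P x)) = - Im (cinner (blinfun_apply P x) y)"
      by (metis cinner_commute cnj.sel(2))
    ultimately show ?thesis by simp
  qed
  show ?thesis
  proof (rule radj_unique)
    fix x y
    show "Re (cinner (blinfun_apply P x) y) = Re (cinner x (blinfun_apply P y))"
      using im[of "\<i> *\<^sub>C x" y] lin by (simp add: clinear_op_def cinner_i_left)
  qed
qed

text \<open>The bound on \<open>A\<close> gives injectivity and a bounded inverse. The bound on its
  adjoint makes the form of \<open>A o\<^sub>L radj A\<close> coercive, so
  \<open>A (radj A z) = w\<close> is solvable for every \<open>w\<close>. The constant 1 is the one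
  that the diagonal blocks of a J-unitary satisfy.\<close>

lemma op_invertible_of_bounded_below:
  fixes A :: "'a::chilbert_space \<Rightarrow>\<^sub>L 'a"
  assumes A: "\<And>x. norm x \<le> norm (blinfun_apply A x)"
    and A': "\<And>x. norm x \<le> norm (blinfun_apply (radj A) x)"
  shows "op_invertible A"
proof -
  have surj: "\<exists>z. blinfun_apply A z = w" for w
  proof -
    have "\<exists>z. \<forall>y. Re (cinner (blinfun_apply (radj A) z) (blinfun_apply (radj A) y)) = Re (cinner w y)"
    proof (rule coercive_form_represents)
      show "bounded_bilinear (\<lambda>z y. Re (cinner (blinfun_apply (radj A) z) (blinfun_apply (radj A) y)))"
        by (rule bounded_bilinear.comp[OF bounded_bilinear_Re_cinner
              blinfun.bounded_linear_right blinfun.bounded_linear_right])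
      show "(norm x)\<^sup>2 \<le> Re (cinner (blinfun_apply (radj A) x) (blinfun_apply (radj A) x))" for x
        using A'[of x] by (simp add: cinner_self)
      show "bounded_linear (\<lambda>y. Re (cinner w y))"
        by (rule bounded_bilinear.bounded_linear_right[OF bounded_bilinear_Re_cinner])
    qed (rule Re_cinner_commute)
    then obtain z where z:
      "\<And>y. Re (cinner (blinfun_apply (radj A) z) (blinfun_apply (radj A) y)) = Re (cinner w y)"
      by blast
    have "blinfun_apply A (blinfun_apply (radj A) z) = w"
      by (rule Re_cinner_ext) (metis z Re_cinner_commute Re_cinner_radj)
    then show ?thesis by blast
  qed
  then obtain g where g: "\<And>w. blinfun_apply A (g w) = w" by metis
  have inj: "x = y" if "blinfun_apply A x = blinfun_apply A y" for x y
    using A[of "x - y"] that by (simp add: blinfun.diff_right)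
  have "bounded_linear g"
  proof (rule bounded_linear_intro)
    show "g (x + y) = g x + g y" for x y by (rule inj) (simp add: g blinfun.add_right)
    show "g (r *\<^sub>R x) = r *\<^sub>R g x" for r x by (rule inj) (simp add: g blinfun.scaleR_right)
    show "norm (g y) \<le> norm y * 1" for y using A[of "g y"] by (simp add: g)
  qed
  then have "blinfun_apply (Blinfun g) = g" by (rule bounded_linear_Blinfun_apply)
  moreover have "g (blinfun_apply A x) = x" for x by (rule inj) (simp add: g)
  ultimately have "Blinfun g o\<^sub>L A = id_blinfun" "A o\<^sub>L Blinfun g = id_blinfun"
    by (simp_all add: blinfun_eqI g)
  then show ?thesis unfolding op_invertible_def by blast
qed

lemma blinfun_eq_iff: "A = B \<longleftrightarrow> (\<forall>x. blinfun_apply A x = blinfun_apply B x)"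
  by (auto intro: blinfun_eqI)

lemma radj_radj: "radj (radj A) = A"
  by (rule radj_unique) (metis Re_cinner_commute Re_cinner_radj)

lemma op_inv_left: "op_invertible A \<Longrightarrow> blinfun_apply (op_inv A) (blinfun_apply A x) = x"
  and op_inv_right: "op_invertible A \<Longrightarrow> blinfun_apply A (blinfun_apply (op_inv A) x) = x"
proof -
  assume "op_invertible A"
  then have "op_inv A o\<^sub>L A = id_blinfun \<and> A o\<^sub>L op_inv A = id_blinfun"
    unfolding op_invertible_def op_inv_def by (rule someI_ex)
  then show "blinfun_apply (op_inv A) (blinfun_apply A x) = x"
    "blinfun_apply A (blinfun_apply (op_inv A) x) = x"
    by (metis blinfun_apply_blinfun_compose blinfun_apply_id_blinfun)+
qed

lemma blk_apply:
  "blinfun_apply (blk a b c d) u = (blinfun_apply a (fst u) + blinfun_apply b (snd u),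
     blinfun_apply c (fst u) + blinfun_apply d (snd u))"
proof -
  have "bounded_linear (\<lambda>u. (blinfun_apply a (fst u) + blinfun_apply b (snd u),
     blinfun_apply c (fst u) + blinfun_apply d (snd u)))"
    by (intro bounded_linear_Pair bounded_linear_add
        bounded_linear_compose[OF blinfun.bounded_linear_right bounded_linear_fst]
        bounded_linear_compose[OF blinfun.bounded_linear_right bounded_linear_snd])
  then show ?thesis
    by (simp add: blk_def bounded_linear_Blinfun_apply case_prod_beta')
qed

lemma bounded_linear_Pair_zero: "bounded_linear (\<lambda>x. (x, 0))" "bounded_linear (\<lambda>x. (0, x))"
  by (intro bounded_linear_Pair bounded_linear_ident bounded_linear_zero)+

lemma ent_apply:
  shows ent11_apply: "blinfun_apply (ent11 T) x = fst (blinfun_apply T (x, 0))"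
    and ent12_apply: "blinfun_apply (ent12 T) x = fst (blinfun_apply T (0, x))"
    and ent21_apply: "blinfun_apply (ent21 T) x = snd (blinfun_apply T (x, 0))"
    and ent22_apply: "blinfun_apply (ent22 T) x = snd (blinfun_apply T (0, x))"
proof -
  note T = bounded_linear_compose[OF blinfun.bounded_linear_right[of T]]
  note fst_T = bounded_linear_compose[OF bounded_linear_fst T]
    and snd_T = bounded_linear_compose[OF bounded_linear_snd T]
  show "blinfun_apply (ent11 T) x = fst (blinfun_apply T (x, 0))"
    "blinfun_apply (ent12 T) x = fst (blinfun_apply T (0, x))"
    "blinfun_apply (ent21 T) x = snd (blinfun_apply T (x, 0))"
    "blinfun_apply (ent22 T) x = snd (blinfun_apply T (0, x))"
    by (simp_all add: ent11_def ent12_def ent21_def ent22_def bounded_linear_Blinfun_apply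
        fst_T snd_T bounded_linear_Pair_zero)
qed

lemma Jop_apply: "blinfun_apply Jop u = (fst u, - snd u)"
  by (simp add: Jop_def blk_apply blinfun.minus_left)

lemma imag_op_apply: "blinfun_apply imag_op x = \<i> *\<^sub>C x"
proof -
  have "bounded_linear (\<lambda>x :: 'a. \<i> *\<^sub>C x)"
    by (rule bounded_linear_intro[where K = 1])
      (simp_all add: scaleC_add_right scaleC_scaleR_commute norm_scaleC_i)
  then show ?thesis by (simp add: imag_op_def bounded_linear_Blinfun_apply)
qed

lemma radj_Jop: "radj Jop = Jop"
  by (rule radj_unique) (simp add: Jop_apply cinner_prod_def cinner_minus_left cinner_minus_right)

lemma radj_imag_op: "radj imag_op = - imag_op"
  by (rule radj_unique)
    (simp add: imag_op_apply blinfun.minus_left cinner_minus_right cinner_scaleC_left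
      cinner_scaleC_right)

lemma clinear_op_Jop: "clinear_op Jop"
  by (simp add: clinear_op_def Jop_apply scaleC_prod_def scaleC_minus_right)

lemma clinear_op_imag_op: "clinear_op imag_op"
  by (simp add: clinear_op_def imag_op_apply scaleC_scaleC mult.commute)

lemma clinear_op_compose: "clinear_op A \<Longrightarrow> clinear_op B \<Longrightarrow> clinear_op (A o\<^sub>L B)"
  by (simp add: clinear_op_def)

lemma clinear_op_add: "clinear_op A \<Longrightarrow> clinear_op B \<Longrightarrow> clinear_op (A + B)"
  by (simp add: clinear_op_def blinfun.add_left scaleC_add_right)

lemma clinear_op_scaleR: "clinear_op A \<Longrightarrow> clinear_op (r *\<^sub>R A)"
  by (simp add: clinear_op_def blinfun.scaleR_left scaleC_scaleR_commute)

text \<open>Operators here are real linear already, so only multiplication by \<open>\<i>\<close>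
  remains to be checked. As a single operator equation, complex linearity can be passed through
  \<open>radj\<close> and through a differential equation.\<close>

lemma clinear_op_iff_commute_imag: "clinear_op A \<longleftrightarrow> A o\<^sub>L imag_op = imag_op o\<^sub>L A"
proof
  assume "clinear_op A"
  then show "A o\<^sub>L imag_op = imag_op o\<^sub>L A"
    by (intro blinfun_eqI) (simp add: clinear_op_def imag_op_apply)
next
  assume "A o\<^sub>L imag_op = imag_op o\<^sub>L A"
  then have i: "blinfun_apply A (\<i> *\<^sub>C x) = \<i> *\<^sub>C blinfun_apply A x" for x
    by (metis blinfun_apply_blinfun_compose imag_op_apply)
  have c: "c *\<^sub>C y = Re c *\<^sub>R y + Im c *\<^sub>R (\<i> *\<^sub>C y)" for c and y :: 'a
    by (metis complex_eq mult.commute scaleC_add_left scaleC_scaleC scaleR_scaleC)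
  show "clinear_op A" unfolding clinear_op_def
    by (subst (1 2) c) (simp add: blinfun.add_right blinfun.scaleR_right i)
qed

text \<open>Taking adjoints reverses the commutation with \<open>imag_op\<close> and changes the
  sign on both sides.\<close>

lemma clinear_op_radj: "clinear_op A \<Longrightarrow> clinear_op (radj A)"
  unfolding clinear_op_iff_commute_imag
  by (drule arg_cong[of _ _ radj])
    (simp add: radj_compose radj_imag_op blinfun_eq_iff blinfun.minus_left blinfun.minus_right)

subsection \<open>The scattering map of a \<open>J\<close>-unitary\<close>

text \<open>Invertibility is encoded by the second identity: since \<open>Jop\<close> squares to the
  identity, the two equations say that \<open>Jop o\<^sub>L radj T o\<^sub>L Jop\<close> is a
  two-sided inverse of \<open>T\<close>. Unlike the existence of an inverse, these are equations
  that an evolution can propagate, and the pair is symmetric under passing from \<open>T\<close> to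
  \<open>radj T\<close>.\<close>

definition J_biunitary :: "(('h::chilbert_space \<times> 'h) \<Rightarrow>\<^sub>L ('h \<times> 'h)) \<Rightarrow> bool" where
  "J_biunitary T \<longleftrightarrow> clinear_op T \<and> radj T o\<^sub>L Jop o\<^sub>L T = Jop \<and> T o\<^sub>L Jop o\<^sub>L radj T = Jop"

lemma J_biunitary_apply:
  assumes "J_biunitary T"
  shows "blinfun_apply (radj T) (blinfun_apply Jop (blinfun_apply T u)) = blinfun_apply Jop u"
    and "blinfun_apply T (blinfun_apply Jop (blinfun_apply (radj T) u)) = blinfun_apply Jop u"
  using assms unfolding J_biunitary_def by (metis blinfun_apply_blinfun_compose)+

lemma J_unitary_imp_J_biunitary:
  fixes T :: "('h::chilbert_space \<times> 'h) \<Rightarrow>\<^sub>L ('h \<times> 'h)"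
  assumes "J_unitary T"
  shows "J_biunitary T"
proof -
  have lin: "clinear_op T" and inv: "op_invertible T" and J: "radj T o\<^sub>L Jop o\<^sub>L T = Jop"
    using assms by (auto simp: J_unitary_def adj_eq_radj)
  have "blinfun_apply (T o\<^sub>L Jop o\<^sub>L radj T) u = blinfun_apply Jop u" for u
  proof -
    define v where "v = blinfun_apply (op_inv T) (blinfun_apply Jop u)"
    have v: "blinfun_apply T v = blinfun_apply Jop u" by (simp add: v_def op_inv_right inv)
    have "blinfun_apply (radj T) (blinfun_apply Jop (blinfun_apply T v)) = blinfun_apply Jop v"
      using J by (metis blinfun_apply_blinfun_compose)
    then have "blinfun_apply (radj T) u = blinfun_apply Jop v" by (simp add: v Jop_apply)
    then show ?thesis using v by (simp add: Jop_apply)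
  qed
  then have "T o\<^sub>L Jop o\<^sub>L radj T = Jop" by (rule blinfun_eqI)
  then show ?thesis using lin J by (simp add: J_biunitary_def)
qed

lemma J_biunitary_radj: "J_biunitary T \<Longrightarrow> J_biunitary (radj T)"
  by (simp add: J_biunitary_def radj_radj clinear_op_radj)

lemma J_biunitary_cinner:
  assumes "J_biunitary T"
  shows "cinner (blinfun_apply T u) (blinfun_apply Jop (blinfun_apply T v)) = cinner u (blinfun_apply Jop v)"
proof -
  have "clinear_op T" using assms by (simp add: J_biunitary_def)
  then show ?thesis by (simp add: cinner_radj J_biunitary_apply(1)[OF assms])
qed

lemma J_biunitary_norm:
  assumes "J_biunitary T"
  shows "(norm (fst (blinfun_apply T u)))\<^sup>2 + (norm (snd u))\<^sup>2
       = (norm (fst u))\<^sup>2 + (norm (snd (blinfun_apply T u)))\<^sup>2"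
  using J_biunitary_cinner[OF assms, of u u]
  by (simp add: Jop_apply cinner_prod_def cinner_minus_right cinner_self complex_eq_iff)

lemma radj_ent:
  fixes T :: "('h::chilbert_space \<times> 'h) \<Rightarrow>\<^sub>L ('h \<times> 'h)"
  shows radj_ent11: "radj (ent11 T) = ent11 (radj T)"
    and radj_ent22: "radj (ent22 T) = ent22 (radj T)"
proof -
  note T = Re_cinner_radj[of T, unfolded cinner_prod_def]
  show "radj (ent11 T) = ent11 (radj T)"
  proof (rule radj_unique)
    show "Re (cinner (blinfun_apply (ent11 T) x) y) = Re (cinner x (blinfun_apply (ent11 (radj T)) y))"
      for x y using T[of "(x, 0)" "(y, 0)"] by (simp add: ent11_apply)
  qed
  show "radj (ent22 T) = ent22 (radj T)"
  proof (rule radj_unique)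
    show "Re (cinner (blinfun_apply (ent22 T) x) y) = Re (cinner x (blinfun_apply (ent22 (radj T)) y))"
      for x y using T[of "(0, x)" "(0, y)"] by (simp add: ent22_apply)
  qed
qed

text \<open>On \<open>(x, 0)\<close> the norm identity says that the square norm of
  \<open>a x\<close> is that of \<open>x\<close> plus that of \<open>c x\<close>; on
  \<open>(0, x)\<close> it says that the square norm of \<open>d x\<close> is that of
  \<open>x\<close> plus that of \<open>b x\<close>.\<close>

lemma norm_ent_ge:
  assumes "J_biunitary T"
  shows "norm x \<le> norm (blinfun_apply (ent11 T) x)" "norm x \<le> norm (blinfun_apply (ent22 T) x)"
proof -
  have "(norm x)\<^sup>2 \<le> (norm (blinfun_apply (ent11 T) x))\<^sup>2"
    using J_biunitary_norm[OF assms, of "(x, 0)"] by (simp add: ent11_apply)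
  then show "norm x \<le> norm (blinfun_apply (ent11 T) x)" by (rule power2_le_imp_le) simp
  have "(norm (fst (blinfun_apply T (0, x))))\<^sup>2 + (norm x)\<^sup>2 = (norm (blinfun_apply (ent22 T) x))\<^sup>2"
    using J_biunitary_norm[OF assms, of "(0, x)"] by (simp add: ent22_apply)
  then have "(norm x)\<^sup>2 \<le> (norm (blinfun_apply (ent22 T) x))\<^sup>2"
    using zero_le_power2[of "norm (fst (blinfun_apply T (0, x)))"] by linarith
  then show "norm x \<le> norm (blinfun_apply (ent22 T) x)" by (rule power2_le_imp_le) simp
qed

lemma op_invertible_ent:
  assumes "J_biunitary T"
  shows "op_invertible (ent11 T)" "op_invertible (ent22 T)"
  using norm_ent_ge[OF assms] norm_ent_ge[OF J_biunitary_radj[OF assms]]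
  by (auto intro!: op_invertible_of_bounded_below simp: radj_ent)

lemma Pair_split: "(x, y) = (x, 0) + (0 :: 'a::monoid_add, y :: 'b::monoid_add)"
  by simp

text \<open>The upper left entry of \<open>Vmap\<close> uses the adjoint of \<open>a\<close>, while
  the scattering relation needs \<open>a - b d^-1 c\<close>. J-unitarity identifies the Schur
  complement with the inverse of that adjoint; the other three entries then match by direct
  computation.\<close>

lemma Vmap_apply:
  assumes "J_biunitary T"
  shows "blinfun_apply (Vmap T) (fst u, snd (blinfun_apply T u)) = (fst (blinfun_apply T u), snd u)"
proof -
  let ?a = "blinfun_apply (ent11 T)" and ?b = "blinfun_apply (ent12 T)"
    and ?c = "blinfun_apply (ent21 T)" and ?d = "blinfun_apply (ent22 T)"
    and ?di = "blinfun_apply (op_inv (ent22 T))"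
  have T: "blinfun_apply T (x, y) = (?a x + ?b y, ?c x + ?d y)" for x y
    by (subst Pair_split, subst blinfun.add_right) (simp add: ent_apply prod_eq_iff)
  have lin: "clinear_op (ent11 T)"
  proof -
    have "blinfun_apply T (c *\<^sub>C x, 0) = c *\<^sub>C blinfun_apply T (x, 0)" for c x
      using assms unfolding J_biunitary_def clinear_op_def
      by (metis cinner_eq_zero_iff cinner_scaleC_left cinner_zero_left fst_conv mult_zero_right
          scaleC_prod_def snd_conv)
    then show ?thesis by (simp add: clinear_op_def ent11_apply scaleC_prod_def)
  qed
  have ainv: "op_invertible (ent11 (radj T))"
    by (rule op_invertible_ent[OF J_biunitary_radj[OF assms]])
  note d = op_inv_left[OF op_invertible_ent(2)[OF assms]] op_inv_right[OF op_invertible_ent(2)[OF assms]]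
  obtain x y where u: "u = (x, y)" by (cases u)
  \<comment> \<open>With this \<open>z\<close> the second component of \<open>T (x, z)\<close>
    vanishes and the first is the Schur complement applied to \<open>x\<close>. Applying
    \<open>radj T\<close> after \<open>Jop\<close> returns \<open>(x, - z)\<close>, whose first
    component is the claim for the adjoint of \<open>a\<close>.\<close>
  define z where "z = - ?di (?c x)"
  have cz: "?c x + ?d z = 0" by (simp add: z_def blinfun.minus_right d)
  have "blinfun_apply (radj T) (?a x + ?b z, 0) = (x, - z)"
    using J_biunitary_apply(1)[OF assms, of "(x, z)"] by (simp add: T Jop_apply cz)
  then have "blinfun_apply (ent11 (radj T)) (?a x + ?b z) = x" by (simp add: ent11_apply)
  then have "blinfun_apply (op_inv (adj (ent11 T))) x = ?a x + ?b z"
    using op_inv_left[OF ainv, of "?a x + ?b z"] by (simp add: adj_eq_radj[OF lin] radj_ent11)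
  then show ?thesis
    by (simp add: Vmap_def blk_apply u T blinfun.minus_left z_def blinfun.add_right
        blinfun.minus_right d)
qed

text \<open>Prescribing the second output component means solving \<open>c x + d z = snd w\<close>
  for \<open>z\<close>, and \<open>d\<close> is invertible.\<close>

lemma scattering_coordinates_surj:
  assumes "J_biunitary T"
  shows "\<exists>u. (fst u, snd (blinfun_apply T u)) = w"
proof -
  define z where "z = blinfun_apply (op_inv (ent22 T)) (snd w - blinfun_apply (ent21 T) (fst w))"
  have "snd (blinfun_apply T (fst w, z)) = blinfun_apply (ent21 T) (fst w) + blinfun_apply (ent22 T) z"
    by (subst Pair_split, subst blinfun.add_right) (simp add: ent_apply)
  also have "\<dots> = snd w"
    by (simp add: z_def op_inv_right[OF op_invertible_ent(2)[OF assms]])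
  finally show ?thesis by (intro exI[of _ "(fst w, z)"]) simp
qed

lemma cinner_Vmap:
  assumes "J_biunitary T"
  shows "cinner (blinfun_apply (Vmap T) x) (blinfun_apply (Vmap T) y) = cinner x y"
proof -
  obtain u v where x: "x = (fst u, snd (blinfun_apply T u))" and y: "y = (fst v, snd (blinfun_apply T v))"
    using scattering_coordinates_surj[OF assms] by metis
  show ?thesis
    using J_biunitary_cinner[OF assms, of u v]
    by (simp add: x y Vmap_apply[OF assms] cinner_prod_def Jop_apply cinner_minus_right algebra_simps)
qed

text \<open>The bound does not depend on the size of \<open>T\<close>; this uniformity yields
  continuity of V along a path before its differentiability.\<close>

lemma norm_Vmap_le:
  assumes "J_biunitary T"
  shows "norm (Vmap T) \<le> 1"
  by (rule norm_blinfun_bound) (simp_all add: norm_eq_sqrt_cinner cinner_Vmap[OF assms])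

lemma clinear_op_Vmap:
  assumes "J_biunitary T"
  shows "clinear_op (Vmap T)"
  unfolding clinear_op_def
proof (intro allI)
  fix c x
  obtain u where u: "(fst u, snd (blinfun_apply T u)) = x"
    using scattering_coordinates_surj[OF assms] by metis
  have "blinfun_apply T (c *\<^sub>C u) = c *\<^sub>C blinfun_apply T u"
    using assms unfolding J_biunitary_def clinear_op_def by blast
  then show "blinfun_apply (Vmap T) (c *\<^sub>C x) = c *\<^sub>C blinfun_apply (Vmap T) x"
    using Vmap_apply[OF assms, of "c *\<^sub>C u"] Vmap_apply[OF assms, of u]
    by (simp add: u[symmetric] scaleC_prod_def)
qed

lemma cinner_adj_Vmap:
  assumes "J_biunitary T"
  shows "cinner x (blinfun_apply (adj (Vmap T)) y) = cinner (blinfun_apply (Vmap T) x) y"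
  by (simp add: adj_eq_radj clinear_op_Vmap[OF assms] cinner_radj)

section \<open>Differentiating the scattering map along a parameter\<close>

lemma has_vector_derivative_iff_slope:
  fixes f :: "real \<Rightarrow> 'a::real_normed_vector"
  shows "(f has_vector_derivative D) (at t within X)
     \<longleftrightarrow> ((\<lambda>s. (f s - f t) /\<^sub>R (s - t)) \<longlongrightarrow> D) (at t within X)"
proof -
  have eq: "norm (f s - f t - (s - t) *\<^sub>R D) / norm (s - t) = norm ((f s - f t) /\<^sub>R (s - t) - D)"
    if "s \<noteq> t" for s
  proof -
    have "(f s - f t) /\<^sub>R (s - t) - D = (f s - f t - (s - t) *\<^sub>R D) /\<^sub>R (s - t)"
      using that by (simp add: scaleR_diff_right)
    then show ?thesis by (simp add: divide_inverse mult.commute)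
  qed
  have "(f has_vector_derivative D) (at t within X) \<longleftrightarrow>
      ((\<lambda>s. norm (f s - f t - (s - t) *\<^sub>R D) / norm (s - t)) \<longlongrightarrow> 0) (at t within X)"
    by (simp add: has_vector_derivative_def has_derivative_iff_norm bounded_linear_scaleR_left)
  also have "\<dots> \<longleftrightarrow> ((\<lambda>s. norm ((f s - f t) /\<^sub>R (s - t) - D)) \<longlongrightarrow> 0) (at t within X)"
    by (intro Lim_cong_within refl eq)
  finally show ?thesis by (simp add: tendsto_norm_zero_iff Lim_null[symmetric])
qed

text \<open>The set \<open>X\<close> is left arbitrary so that the same statement serves the time
  derivative on a half line and the two-sided derivative in the energy. Besides differentiability it
  delivers the quadratic form of the logarithmic derivative in the coordinates S u, which is all
  that the sign statements use.\<close>

lemma Vmap_has_vector_derivative: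
  fixes T :: "real \<Rightarrow> (('h::chilbert_space \<times> 'h) \<Rightarrow>\<^sub>L ('h \<times> 'h))"
  assumes uni: "\<And>s. s \<in> X \<Longrightarrow> J_biunitary (T s)" and t: "t \<in> X"
    and D: "(T has_vector_derivative D) (at t within X)"
  obtains D' where "((\<lambda>s. Vmap (T s)) has_vector_derivative D') (at t within X)"
    and "\<And>u. cinner (fst u, snd (blinfun_apply (T t) u))
         (blinfun_apply ((- imag_op) o\<^sub>L adj (Vmap (T t)) o\<^sub>L D') (fst u, snd (blinfun_apply (T t) u)))
       = - \<i> * cinner (blinfun_apply (T t) u) (blinfun_apply Jop (blinfun_apply D u))"
proof -
  define p q :: "('h \<times> 'h) \<Rightarrow>\<^sub>L ('h \<times> 'h)"
    where "p = blk id_blinfun 0 0 0" and "q = blk 0 0 0 id_blinfun"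
  have p: "blinfun_apply p u = (fst u, 0)" and q: "blinfun_apply q u = (0, snd u)" for u
    by (simp_all add: p_def q_def blk_apply)
  define V where "V s = Vmap (T s)" for s
  \<comment> \<open>\<open>W\<close> is the inverse of S at \<open>t\<close>: the first component of
    S u is that of \<open>u\<close>, and applying V to S u gives R u, whose second component is that
    of \<open>u\<close>.\<close>
  define W where "W = p + (q o\<^sub>L V t)"
  have W: "blinfun_apply W (fst u, snd (blinfun_apply (T t) u)) = u" for u
    by (simp add: W_def blinfun.add_left p q V_def Vmap_apply[OF uni[OF t]])
  \<comment> \<open>With \<open>x\<close> equal to S u at \<open>t\<close>, subtract V(s) applied to
    the increment of S from the increment of R; the increments are \<open>q\<close> and
    \<open>p\<close> applied to \<open>(T s - T t) u\<close>. The identity is exact and has no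
    remainder term.\<close>
  have diff: "V s - V t = ((p o\<^sub>L (T s - T t)) - (V s o\<^sub>L q o\<^sub>L (T s - T t))) o\<^sub>L W" if s: "s \<in> X" for s
  proof (rule blinfun_eqI)
    fix x
    obtain u where u: "x = (fst u, snd (blinfun_apply (T t) u))"
      using scattering_coordinates_surj[OF uni[OF t]] by metis
    have "(0, snd (blinfun_apply (T s) u) - snd (blinfun_apply (T t) u))
        = (fst u, snd (blinfun_apply (T s) u)) - (fst u, snd (blinfun_apply (T t) u))" by simp
    then have Vq: "blinfun_apply (V s) (0, snd (blinfun_apply (T s) u) - snd (blinfun_apply (T t) u))
        = (fst (blinfun_apply (T s) u), snd u) - blinfun_apply (V s) x"
      by (simp only: blinfun.diff_right V_def Vmap_apply[OF uni[OF s]] u)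
    have Vt: "blinfun_apply (V t) x = (fst (blinfun_apply (T t) u), snd u)"
      unfolding V_def u by (rule Vmap_apply[OF uni[OF t]])
    have Wx: "blinfun_apply W x = u" unfolding u by (rule W)
    show "blinfun_apply (V s - V t) x
        = blinfun_apply (((p o\<^sub>L (T s - T t)) - (V s o\<^sub>L q o\<^sub>L (T s - T t))) o\<^sub>L W) x"
      by (simp add: blinfun.diff_left Wx Vt p q Vq)
  qed
  have D_lim: "((\<lambda>s. (T s - T t) /\<^sub>R (s - t)) \<longlongrightarrow> D) (at t within X)"
    using D by (simp add: has_vector_derivative_iff_slope)
  have T_lim: "(T \<longlongrightarrow> T t) (at t within X)"
    using has_vector_derivative_continuous[OF D] by (simp add: continuous_within)
  have ev: "\<forall>\<^sub>F s in at t within X. s \<in> X" by (simp add: eventually_at_filter)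
  \<comment> \<open>The difference formula still contains \<open>V s\<close>. Its uniform bound
    gives continuity, which then permits passing to the limit in the difference quotient.\<close>
  have V_lim: "(V \<longlongrightarrow> V t) (at t within X)"
  proof (rule LIM_zero_cancel, rule Lim_null_comparison)
    have "((\<lambda>s. (norm p + norm q) * norm (T s - T t) * norm W) \<longlongrightarrow> (norm p + norm q) * 0 * norm W)
        (at t within X)"
      by (intro tendsto_intros tendsto_norm_zero LIM_zero T_lim)
    then show "((\<lambda>s. (norm p + norm q) * norm (T s - T t) * norm W) \<longlongrightarrow> 0) (at t within X)" by simp
    have "norm (V s - V t) \<le> (norm p + norm q) * norm (T s - T t) * norm W" if s: "s \<in> X" for s
    proof -
      have "norm (V s o\<^sub>L q o\<^sub>L (T s - T t)) \<le> norm (V s o\<^sub>L q) * norm (T s - T t)"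
        by (rule norm_blinfun_compose)
      also have "norm (V s o\<^sub>L q) \<le> norm (V s) * norm q" by (rule norm_blinfun_compose)
      also have "norm (V s) \<le> 1" unfolding V_def by (rule norm_Vmap_le[OF uni[OF s]])
      finally have 1: "norm (V s o\<^sub>L q o\<^sub>L (T s - T t)) \<le> 1 * norm q * norm (T s - T t)"
        by (simp add: mult_right_mono)
      have "norm (V s - V t) \<le> norm ((p o\<^sub>L (T s - T t)) - (V s o\<^sub>L q o\<^sub>L (T s - T t))) * norm W"
        unfolding diff[OF s] by (rule norm_blinfun_compose)
      also have "\<dots> \<le> (norm p * norm (T s - T t) + 1 * norm q * norm (T s - T t)) * norm W"
        by (intro mult_right_mono order_trans[OF norm_triangle_ineq4] add_mono 1
            norm_blinfun_compose) simp
      finally show ?thesis by (simp add: algebra_simps)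
    qed
    then show "\<forall>\<^sub>F s in at t within X. norm (V s - V t) \<le> (norm p + norm q) * norm (T s - T t) * norm W"
      using ev by (rule eventually_mono[rotated])
  qed
  define D' where "D' = ((p o\<^sub>L D) - (V t o\<^sub>L q o\<^sub>L D)) o\<^sub>L W"
  have "((\<lambda>s. ((p o\<^sub>L ((T s - T t) /\<^sub>R (s - t))) - (V s o\<^sub>L q o\<^sub>L ((T s - T t) /\<^sub>R (s - t)))) o\<^sub>L W) \<longlongrightarrow> D')
      (at t within X)"
    unfolding D'_def by (intro tendsto_intros V_lim D_lim)
  moreover have "((p o\<^sub>L ((T s - T t) /\<^sub>R (s - t))) - (V s o\<^sub>L q o\<^sub>L ((T s - T t) /\<^sub>R (s - t)))) o\<^sub>L W
      = (V s - V t) /\<^sub>R (s - t)" if "s \<in> X" for s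
    by (subst diff[OF that]) (rule blinfun_eqI, simp add: blinfun.bilinear_simps scaleR_diff_right)
  ultimately have "((\<lambda>s. (V s - V t) /\<^sub>R (s - t)) \<longlongrightarrow> D') (at t within X)"
    using ev by (rule Lim_transform_eventually[OF _ eventually_mono[rotated]])
  then have deriv: "((\<lambda>s. Vmap (T s)) has_vector_derivative D') (at t within X)"
    by (simp add: has_vector_derivative_iff_slope V_def)
  have form: "cinner (fst u, snd (blinfun_apply (T t) u))
         (blinfun_apply ((- imag_op) o\<^sub>L adj (Vmap (T t)) o\<^sub>L D') (fst u, snd (blinfun_apply (T t) u)))
       = - \<i> * cinner (blinfun_apply (T t) u) (blinfun_apply Jop (blinfun_apply D u))" for u
  proof -
    let ?x = "(fst u, snd (blinfun_apply (T t) u))"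
    have "cinner ?x (blinfun_apply (adj (V t)) (blinfun_apply D' ?x))
        = cinner (blinfun_apply (V t) ?x) (blinfun_apply D' ?x)"
      unfolding V_def by (rule cinner_adj_Vmap[OF uni[OF t]])
    also have "\<dots> = cinner (blinfun_apply (V t) ?x) (blinfun_apply p (blinfun_apply D u))
        - cinner ?x (blinfun_apply q (blinfun_apply D u))"
      by (simp add: D'_def blinfun.diff_left W cinner_diff_right V_def cinner_Vmap[OF uni[OF t]])
    also have "\<dots> = cinner (blinfun_apply (T t) u) (blinfun_apply Jop (blinfun_apply D u))"
      by (simp add: V_def Vmap_apply[OF uni[OF t]] p q cinner_prod_def Jop_apply cinner_minus_right)
    finally show ?thesis
      by (simp add: V_def blinfun.minus_left imag_op_apply cinner_minus_right cinner_scaleC_right)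
  qed
  show thesis by (rule that[OF deriv form])
qed

subsection \<open>Linear evolution equations\<close>

text \<open>A mean value inequality with a scalar majorant \<open>g\<close>. A constant
  \<open>g\<close> gives conservation laws, a linear one Lipschitz bounds, and an exponential one
  the step behind the growth estimate.\<close>

lemma norm_increment_le:
  fixes f :: "real \<Rightarrow> 'a::real_normed_vector"
  assumes t: "0 \<le> t"
    and f: "\<And>s. s \<in> {0..t} \<Longrightarrow> (f has_vector_derivative f' s) (at s within {0..t})"
    and g: "\<And>s. (g has_vector_derivative g' s) (at s)"
    and le: "\<And>s. s \<in> {0..t} \<Longrightarrow> norm (f' s) \<le> g' s"
  shows "norm (f t - f 0) \<le> g t - g 0"
proof (cases "t = 0")
  case False
  show ?thesis
  proof (rule differentiable_bound_general)
    show "0 < t" using t False by simp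
    show "continuous_on {0..t} f"
      using has_vector_derivative_continuous[OF f] by (simp add: continuous_on_eq_continuous_within)
    show "continuous_on {0..t} g"
      using g by (meson continuous_at_imp_continuous_on has_vector_derivative_continuous)
    show "(f has_vector_derivative f' s) (at s)" if "0 < s" "s < t" for s
      using f[of s] that by (simp add: at_within_Icc_at)
  qed (use g le in auto)
qed simp

lemma gronwall:
  fixes f :: "real \<Rightarrow> 'a::real_normed_vector"
  assumes K: "0 \<le> K"
    and f: "\<And>s. s \<in> {0..t} \<Longrightarrow> (f has_vector_derivative f' s) (at s within {0..t})"
    and le: "\<And>s. s \<in> {0..t} \<Longrightarrow> norm (f' s) \<le> K * norm (f s)"
    and s: "s \<in> {0..t}"
  shows "norm (f s) \<le> 2 * norm (f 0) * exp (2 * K * s)"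
proof -
  \<comment> \<open>With the weight \<open>exp (- 2 K s)\<close> the integral operator is a contraction with factor \<open>1/2\<close>.\<close>
  define h where "h s = exp (- (2 * K * s)) * norm (f s)" for s
  have "continuous_on {0..t} f"
    using has_vector_derivative_continuous[OF f] by (simp add: continuous_on_eq_continuous_within)
  then have "continuous_on {0..t} h" unfolding h_def by (intro continuous_intros)
  then obtain r where r: "r \<in> {0..t}" and max: "\<And>s. s \<in> {0..t} \<Longrightarrow> h s \<le> h r"
    using continuous_attains_sup[of "{0..t}" h] s by auto
  have fle: "norm (f s) \<le> h r * exp (2 * K * s)" if "s \<in> {0..t}" for s
    using max[OF that] by (simp add: h_def exp_minus field_simps)
  have "norm (f r - f 0) \<le> h r / 2 * exp (2 * K * r) - h r / 2 * exp (2 * K * 0)"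
  proof (rule norm_increment_le)
    show "(f has_vector_derivative f' s) (at s within {0..r})" if "s \<in> {0..r}" for s
      by (rule has_vector_derivative_within_subset[OF f]) (use that r in auto)
    show "((\<lambda>s. h r / 2 * exp (2 * K * s)) has_vector_derivative h r * K * exp (2 * K * s)) (at s)" for s
      by (auto intro!: derivative_eq_intros simp flip: has_real_derivative_iff_has_vector_derivative)
    show "norm (f' s) \<le> h r * K * exp (2 * K * s)" if "s \<in> {0..r}" for s
    proof -
      have "s \<in> {0..t}" using that r by auto
      then show ?thesis
        using le[of s] mult_left_mono[OF fle[of s] K] by (simp add: mult_ac)
    qed
  qed (use r in auto)
  \<comment> \<open>At the maximiser the integral term is half of \<open>norm (f r)\<close> and is
    absorbed on the left; this is the origin of the factor 2 in the estimate.\<close>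
  also have "h r / 2 * exp (2 * K * r) = norm (f r) / 2" by (simp add: h_def exp_minus)
  also have "norm (f r) / 2 - h r / 2 * exp (2 * K * 0) \<le> norm (f r) / 2" by (simp add: h_def)
  finally have "norm (f r) \<le> 2 * norm (f 0)"
    using norm_triangle_ineq2[of "f r" "f 0"] by linarith
  moreover have "h r \<le> norm (f r)"
    using K r mult_right_mono[of "exp (- (2 * K * r))" 1 "norm (f r)"] by (simp add: h_def)
  ultimately have "h r \<le> 2 * norm (f 0)" by simp
  then have "h r * exp (2 * K * s) \<le> 2 * norm (f 0) * exp (2 * K * s)"
    by (rule mult_right_mono) simp
  then show ?thesis using fle[OF s] by linarith
qed

lemmas has_vector_derivative_blinfun_compose =
  bounded_bilinear.has_vector_derivative[OF bounded_bilinear_blinfun_compose]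

lemmas has_vector_derivative_radj =
  bounded_linear.has_vector_derivative[OF bounded_linear_radj]

text \<open>In infinite dimension \<open>T\<^sup>* J T = J\<close> does not make \<open>T\<close> surjective, so \<open>T J T\<^sup>* = J\<close> and complex
  linearity are propagated separately, each as uniqueness for a linear evolution equation.\<close>

lemma J_biunitary_evolution:
  fixes T :: "real \<Rightarrow> (('h::chilbert_space \<times> 'h) \<Rightarrow>\<^sub>L ('h \<times> 'h))"
  assumes t: "0 \<le> t"
    and T: "\<And>s. s \<in> {0..t} \<Longrightarrow> (T has_vector_derivative L s o\<^sub>L T s) (at s within {0..t})"
    and lin: "\<And>s. clinear_op (L s)"
    and skew: "\<And>s. radj (L s) o\<^sub>L Jop = - (Jop o\<^sub>L L s)"
    and K: "\<And>s. s \<in> {0..t} \<Longrightarrow> norm (L s) \<le> K"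
    and init: "J_biunitary (T 0)"
  shows "J_biunitary (T t)"
proof -
  have K0: "0 \<le> K" using order_trans[OF norm_ge_zero K[of 0]] t by simp
  have LJ: "blinfun_apply (radj (L s)) (blinfun_apply Jop x) = - blinfun_apply Jop (blinfun_apply (L s) x)" for s x
    using arg_cong[OF skew[of s], of "\<lambda>A. blinfun_apply A x"] by (simp add: blinfun.minus_left)
  have JJ: "blinfun_apply Jop (blinfun_apply Jop x) = x" for x :: "'h \<times> 'h"
    by (simp add: Jop_apply)
  have lin0: "clinear_op (T 0)" and J0: "radj (T 0) o\<^sub>L Jop o\<^sub>L T 0 = Jop"
    and J0': "T 0 o\<^sub>L Jop o\<^sub>L radj (T 0) = Jop"
    using init by (auto simp: J_biunitary_def)
  have t': "t \<in> {0..t}" using t by simp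

  \<comment> \<open>The commutator with \<open>\<i>\<close> solves the same equation as
    \<open>T\<close>, because \<open>L s\<close> is complex linear; it starts at zero and hence
    stays zero.\<close>
  define X where "X s = (T s o\<^sub>L imag_op) - (imag_op o\<^sub>L T s)" for s
  have "(X has_vector_derivative L s o\<^sub>L X s) (at s within {0..t})" if s: "s \<in> {0..t}" for s
  proof -
    have "(X has_vector_derivative ((T s o\<^sub>L 0) + ((L s o\<^sub>L T s) o\<^sub>L imag_op))
        - ((imag_op o\<^sub>L (L s o\<^sub>L T s)) + (0 o\<^sub>L T s))) (at s within {0..t})"
      unfolding X_def
      by (intro has_vector_derivative_diff has_vector_derivative_blinfun_compose T[OF s]
          has_vector_derivative_const)
    moreover have "((T s o\<^sub>L 0) + ((L s o\<^sub>L T s) o\<^sub>L imag_op))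
        - ((imag_op o\<^sub>L (L s o\<^sub>L T s)) + (0 o\<^sub>L T s)) = L s o\<^sub>L X s"
    proof (rule blinfun_eqI)
      have "blinfun_apply (L s) (\<i> *\<^sub>C x) = \<i> *\<^sub>C blinfun_apply (L s) x" for x
        using lin[of s] unfolding clinear_op_def by blast
      then show "blinfun_apply (((T s o\<^sub>L 0) + ((L s o\<^sub>L T s) o\<^sub>L imag_op))
          - ((imag_op o\<^sub>L (L s o\<^sub>L T s)) + (0 o\<^sub>L T s))) x = blinfun_apply (L s o\<^sub>L X s) x" for x
        by (simp add: X_def blinfun.bilinear_simps imag_op_apply)
    qed
    ultimately show ?thesis by simp
  qed
  from gronwall[OF K0 this _ t']
  have "norm (X t) \<le> 2 * norm (X 0) * exp (2 * K * t)"
    by (meson K mult_right_mono norm_blinfun_compose norm_ge_zero order_trans)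
  moreover have "X 0 = 0" using lin0 by (simp add: X_def clinear_op_iff_commute_imag)
  ultimately have "X t = 0" by simp
  then have "clinear_op (T t)" by (simp add: X_def clinear_op_iff_commute_imag)

  moreover have "radj (T t) o\<^sub>L Jop o\<^sub>L T t = Jop"
  proof -
    \<comment> \<open>This quantity is conserved outright: the two terms of its derivative cancel by
      the skewness of \<open>L s\<close>.\<close>
    have "norm ((radj (T t) o\<^sub>L Jop o\<^sub>L T t) - (radj (T 0) o\<^sub>L Jop o\<^sub>L T 0)) \<le> (0::real) - 0"
    proof (rule norm_increment_le[OF t])
      show "((\<lambda>s. radj (T s) o\<^sub>L Jop o\<^sub>L T s) has_vector_derivative
          ((radj (T s) o\<^sub>L Jop) o\<^sub>L (L s o\<^sub>L T s)) +
          (((radj (T s) o\<^sub>L 0) + (radj (L s o\<^sub>L T s) o\<^sub>L Jop)) o\<^sub>L T s)) (at s within {0..t})"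
        if "s \<in> {0..t}" for s
        by (intro has_vector_derivative_blinfun_compose has_vector_derivative_radj T[OF that]
            has_vector_derivative_const)
      show "norm (((radj (T s) o\<^sub>L Jop) o\<^sub>L (L s o\<^sub>L T s)) +
          (((radj (T s) o\<^sub>L 0) + (radj (L s o\<^sub>L T s) o\<^sub>L Jop)) o\<^sub>L T s)) \<le> 0" for s
        by (simp only: norm_le_zero_iff)
          (rule blinfun_eqI, simp add: radj_compose LJ blinfun.bilinear_simps)
    qed (rule has_vector_derivative_const)
    then show ?thesis by (simp add: J0)
  qed

  moreover have "T t o\<^sub>L Jop o\<^sub>L radj (T t) = Jop"
  proof -
    \<comment> \<open>Here the derivative does not cancel termwise. Skewness makes
      \<open>Jop\<close> a stationary solution of the two-sided equation that
      \<open>T o\<^sub>L Jop o\<^sub>L radj T\<close> solves, so the deviation \<open>Z\<close>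
      solves it too, with zero initial value. The two terms of that equation account for the growth
      constant \<open>2 * K\<close>.\<close>
    define Z where "Z s = (T s o\<^sub>L Jop o\<^sub>L radj (T s)) - Jop" for s
    have LJ': "blinfun_apply Jop (blinfun_apply (radj (L s)) x) = - blinfun_apply (L s) (blinfun_apply Jop x)" for s x
      using LJ[of s "blinfun_apply Jop x"] by (simp add: JJ blinfun.minus_right)
    have Z': "(Z has_vector_derivative (L s o\<^sub>L Z s) + (Z s o\<^sub>L radj (L s))) (at s within {0..t})"
      if s: "s \<in> {0..t}" for s
    proof -
      have "(Z has_vector_derivative (((T s o\<^sub>L Jop) o\<^sub>L radj (L s o\<^sub>L T s)) +
          (((T s o\<^sub>L 0) + ((L s o\<^sub>L T s) o\<^sub>L Jop)) o\<^sub>L radj (T s))) - 0) (at s within {0..t})"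
        unfolding Z_def
        by (intro has_vector_derivative_diff has_vector_derivative_blinfun_compose
            has_vector_derivative_radj T[OF s] has_vector_derivative_const)
      moreover have "(((T s o\<^sub>L Jop) o\<^sub>L radj (L s o\<^sub>L T s)) +
          (((T s o\<^sub>L 0) + ((L s o\<^sub>L T s) o\<^sub>L Jop)) o\<^sub>L radj (T s))) - 0
          = (L s o\<^sub>L Z s) + (Z s o\<^sub>L radj (L s))"
        by (rule blinfun_eqI) (simp add: Z_def radj_compose LJ' blinfun.bilinear_simps)
      ultimately show ?thesis by simp
    qed
    have "norm (Z t) \<le> 2 * norm (Z 0) * exp (2 * (2 * K) * t)"
    proof (rule gronwall[OF _ Z' _ t'])
      show "norm ((L s o\<^sub>L Z s) + (Z s o\<^sub>L radj (L s))) \<le> 2 * K * norm (Z s)" if s: "s \<in> {0..t}" for s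
      proof -
        have "norm (L s o\<^sub>L Z s) \<le> K * norm (Z s)"
          by (meson K[OF s] mult_right_mono norm_blinfun_compose norm_ge_zero order_trans)
        moreover have "norm (Z s o\<^sub>L radj (L s)) \<le> norm (Z s) * K"
          by (meson K[OF s] mult_left_mono norm_blinfun_compose norm_ge_zero norm_radj_le order_trans)
        ultimately show ?thesis
          using norm_triangle_ineq[of "L s o\<^sub>L Z s" "Z s o\<^sub>L radj (L s)"]
          by argo
      qed
    qed (use K0 in auto)
    moreover have "Z 0 = 0" by (simp add: Z_def J0')
    ultimately show ?thesis by (simp add: Z_def)
  qed
  ultimately show ?thesis by (simp add: J_biunitary_def)
qed

text \<open>At \<open>e = E\<close> the right hand side vanishes, so \<open>Y E\<close> is constant
  in time. For nearby \<open>e\<close>, the increment of \<open>Y e\<close> divided by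
  \<open>e - E\<close> is the integral of \<open>B s o\<^sub>L Y e s\<close>, which tends to that of
  \<open>B s o\<^sub>L Y E 0\<close>. The antiderivative \<open>G\<close> stands for this integral,
  and the estimates make the convergence quantitative.\<close>

lemma has_vector_derivative_parameter:
  fixes Y :: "real \<Rightarrow> real \<Rightarrow> ('a::real_normed_vector \<Rightarrow>\<^sub>L 'b::real_normed_vector)"
  assumes t: "0 \<le> t"
    and Y: "\<And>e s. s \<in> {0..t} \<Longrightarrow>
      (Y e has_vector_derivative (e - E) *\<^sub>R (B s o\<^sub>L Y e s)) (at s within {0..t})"
    and K: "\<And>s. s \<in> {0..t} \<Longrightarrow> norm (B s) \<le> K"
    and G: "\<And>s. s \<in> {0..t} \<Longrightarrow> (G has_vector_derivative B s o\<^sub>L Y E 0) (at s within {0..t})"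
    and init: "((\<lambda>e. Y e 0) has_vector_derivative 0) (at E)"
  shows "((\<lambda>e. Y e t) has_vector_derivative G t - G 0) (at E)"
proof -
  have K0: "0 \<le> K" using order_trans[OF norm_ge_zero K[of 0]] t by simp
  have YE: "Y E t = Y E 0"
    using norm_increment_le[OF t Y[where e = E] has_vector_derivative_const[where c = "0::real"]] by simp
  \<comment> \<open>\<open>C\<close> bounds all \<open>Y e s\<close> with \<open>e\<close> within 1
    of \<open>E\<close> and \<open>Y e 0\<close> within 1 of \<open>Y E 0\<close>; for such
    \<open>e\<close> the growth constant is at most \<open>K\<close>.\<close>
  define C where "C = 2 * (norm (Y E 0) + 1) * exp (2 * K * t)"
  \<comment> \<open>\<open>\<delta> e\<close> bounds the distance of \<open>Y e s\<close> from the
    constant \<open>Y E 0\<close>: drift in time plus initial deviation. It tends to 0 as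
    \<open>e\<close> tends to \<open>E\<close>.\<close>
  define \<delta> where "\<delta> e = \<bar>e - E\<bar> * K * C * t + norm (Y e 0 - Y E 0)" for e
  have C0: "0 \<le> C" by (simp add: C_def)
  have BY: "norm ((e - E) *\<^sub>R (B s o\<^sub>L A)) \<le> \<bar>e - E\<bar> * K * norm A"
    if "s \<in> {0..t}" for e s and A :: "'a \<Rightarrow>\<^sub>L 'b"
    using mult_left_mono[OF order_trans[OF norm_blinfun_compose mult_right_mono[OF K[OF that] norm_ge_zero]],
        of "\<bar>e - E\<bar>" A]
    by (simp add: mult.assoc)
  have est: "norm ((Y e t - Y E t) /\<^sub>R (e - E) - (G t - G 0))
      \<le> norm ((Y e 0 - Y E 0) /\<^sub>R (e - E)) + K * \<delta> e * t"
    if e: "\<bar>e - E\<bar> \<le> 1" "e \<noteq> E" and e0: "norm (Y e 0 - Y E 0) \<le> 1" for e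
  proof -
    have YC: "norm (Y e s) \<le> C" if s: "s \<in> {0..t}" for s
    proof -
      have "norm (Y e s) \<le> 2 * norm (Y e 0) * exp (2 * K * s)"
      proof (rule gronwall[OF K0 Y _ s])
        show "norm ((e - E) *\<^sub>R (B r o\<^sub>L Y e r)) \<le> K * norm (Y e r)" if "r \<in> {0..t}" for r
          using BY[OF that, of e "Y e r"] mult_right_mono[OF e(1), of "K * norm (Y e r)"] K0
          by (simp add: mult.assoc)
      qed
      also have "\<dots> \<le> C"
        unfolding C_def using norm_triangle_ineq2[of "Y e 0" "Y E 0"] e0 K0 s
        by (intro mult_mono) (auto intro!: mult_left_mono)
      finally show ?thesis .
    qed
    have Y\<delta>: "norm (Y e s - Y E 0) \<le> \<delta> e" if s: "s \<in> {0..t}" for s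
    proof -
      have "norm (Y e s - Y e 0) \<le> \<bar>e - E\<bar> * K * C * s - \<bar>e - E\<bar> * K * C * 0"
      proof (rule norm_increment_le)
        show "(Y e has_vector_derivative (e - E) *\<^sub>R (B r o\<^sub>L Y e r)) (at r within {0..s})"
          if "r \<in> {0..s}" for r
          by (rule has_vector_derivative_within_subset[OF Y]) (use that s in auto)
        show "((\<lambda>s. \<bar>e - E\<bar> * K * C * s) has_vector_derivative \<bar>e - E\<bar> * K * C) (at r)" for r
          by (auto intro!: derivative_eq_intros simp flip: has_real_derivative_iff_has_vector_derivative)
        show "norm ((e - E) *\<^sub>R (B r o\<^sub>L Y e r)) \<le> \<bar>e - E\<bar> * K * C" if "r \<in> {0..s}" for r
        proof -
          have r: "r \<in> {0..t}" using that s by auto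
          show ?thesis
            using BY[OF r, of e "Y e r"] mult_left_mono[OF YC[OF r], of "\<bar>e - E\<bar> * K"] K0 by simp
        qed
      qed (use s in auto)
      also have "\<dots> \<le> \<bar>e - E\<bar> * K * C * t"
        using s K0 C0 by (simp add: mult_left_mono)
      finally show ?thesis
        using norm_triangle_ineq[of "Y e s - Y e 0" "Y e 0 - Y E 0"] by (simp add: \<delta>_def)
    qed
    \<comment> \<open>Subtracting the expected first order term leaves a function whose derivative
      carries both \<open>e - E\<close> and \<open>Y e s - Y E 0\<close>, so its increment is small
      even after division by \<open>e - E\<close>.\<close>
    define F where "F s = Y e s - (e - E) *\<^sub>R G s" for s
    have "norm (F t - F 0) \<le> \<bar>e - E\<bar> * K * \<delta> e * t - \<bar>e - E\<bar> * K * \<delta> e * 0"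
    proof (rule norm_increment_le[OF t])
      show "(F has_vector_derivative (e - E) *\<^sub>R (B s o\<^sub>L (Y e s - Y E 0))) (at s within {0..t})"
        if s: "s \<in> {0..t}" for s
      proof -
        have "(F has_vector_derivative (e - E) *\<^sub>R (B s o\<^sub>L Y e s) - (e - E) *\<^sub>R (B s o\<^sub>L Y E 0))
            (at s within {0..t})"
          unfolding F_def
          by (intro has_vector_derivative_diff Y[OF s]
              bounded_linear.has_vector_derivative[OF bounded_linear_scaleR_right] G[OF s])
        then show ?thesis
          by (simp add: bounded_bilinear.diff_right[OF bounded_bilinear_blinfun_compose] scaleR_diff_right)
      qed
      show "((\<lambda>s. \<bar>e - E\<bar> * K * \<delta> e * s) has_vector_derivative \<bar>e - E\<bar> * K * \<delta> e) (at r)" for r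
        by (auto intro!: derivative_eq_intros simp flip: has_real_derivative_iff_has_vector_derivative)
      show "norm ((e - E) *\<^sub>R (B s o\<^sub>L (Y e s - Y E 0))) \<le> \<bar>e - E\<bar> * K * \<delta> e"
        if s: "s \<in> {0..t}" for s
        using BY[OF s, of e "Y e s - Y E 0"] mult_left_mono[OF Y\<delta>[OF s], of "\<bar>e - E\<bar> * K"] K0 by simp
    qed
    then have F: "norm (F t - F 0) \<le> \<bar>e - E\<bar> * (K * \<delta> e * t)" by (simp add: mult_ac)
    have "(Y e t - Y E t) /\<^sub>R (e - E) - (G t - G 0)
        = (Y e 0 - Y E 0) /\<^sub>R (e - E) + (F t - F 0) /\<^sub>R (e - E)"
      using e(2) by (simp add: F_def YE scaleR_diff_right)
    also have "norm \<dots> \<le> norm ((Y e 0 - Y E 0) /\<^sub>R (e - E)) + norm ((F t - F 0) /\<^sub>R (e - E))"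
      by (rule norm_triangle_ineq)
    also have "norm ((F t - F 0) /\<^sub>R (e - E)) \<le> K * \<delta> e * t"
      using mult_left_mono[OF F, of "inverse \<bar>e - E\<bar>"] e(2) by (simp add: mult.assoc[symmetric])
    finally show ?thesis by simp
  qed
  have slope0: "((\<lambda>e. (Y e 0 - Y E 0) /\<^sub>R (e - E)) \<longlongrightarrow> 0) (at E)"
    using init by (simp add: has_vector_derivative_iff_slope)
  have lim0: "((\<lambda>e. Y e 0) \<longlongrightarrow> Y E 0) (at E)"
    using has_vector_derivative_continuous[OF init] by (simp add: continuous_within)
  have "((\<lambda>e. norm ((Y e 0 - Y E 0) /\<^sub>R (e - E)) + K * \<delta> e * t)
      \<longlongrightarrow> 0 + K * (\<bar>E - E\<bar> * K * C * t + 0) * t) (at E)"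
    unfolding \<delta>_def by (intro tendsto_intros tendsto_norm_zero slope0 LIM_zero lim0)
  then have bound0: "((\<lambda>e. norm ((Y e 0 - Y E 0) /\<^sub>R (e - E)) + K * \<delta> e * t) \<longlongrightarrow> 0) (at E)"
    by simp
  have "\<forall>\<^sub>F e in at E. \<bar>e - E\<bar> \<le> 1 \<and> e \<noteq> E \<and> norm (Y e 0 - Y E 0) \<le> 1"
  proof (intro eventually_conj)
    show "\<forall>\<^sub>F e in at E. \<bar>e - E\<bar> \<le> 1"
      by (auto simp: eventually_at dist_real_def intro!: exI[of _ 1])
    show "\<forall>\<^sub>F e in at E. e \<noteq> E" by (simp add: eventually_at_filter)
    show "\<forall>\<^sub>F e in at E. norm (Y e 0 - Y E 0) \<le> 1"
      using tendstoD[OF lim0, of 1] by (auto simp: dist_norm elim: eventually_mono)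
  qed
  then have "\<forall>\<^sub>F e in at E. norm ((Y e t - Y E t) /\<^sub>R (e - E) - (G t - G 0))
      \<le> norm ((Y e 0 - Y E 0) /\<^sub>R (e - E)) + K * \<delta> e * t"
    by (rule eventually_mono) (use est in auto)
  then have "((\<lambda>e. (Y e t - Y E t) /\<^sub>R (e - E)) \<longlongrightarrow> G t - G 0) (at E)"
    by (rule LIM_zero_cancel[OF Lim_null_comparison[OF _ bound0]])
  then show ?thesis by (simp add: has_vector_derivative_iff_slope)
qed

section \<open>The evolution equation with \<open>Jop\<close> and the sign of the
  derivatives\<close>

lemma continuous_on_Icc_norm_bounded:
  fixes f :: "real \<Rightarrow> 'a::real_normed_vector"
  assumes "continuous_on {a..b} f"
  obtains K where "\<And>s. s \<in> {a..b} \<Longrightarrow> norm (f s) \<le> K"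
proof -
  have "bounded (f ` {a..b})"
    by (intro compact_imp_bounded compact_continuous_image assms compact_Icc)
  then show thesis using that unfolding bounded_iff by blast
qed

text \<open>Since \<open>Jop\<close> squares to the identity, the given equation solved for the
  derivative reads T' = \<open>generator A o\<^sub>L T\<close>.\<close>

definition generator :: "(('h::chilbert_space \<times> 'h) \<Rightarrow>\<^sub>L ('h \<times> 'h)) \<Rightarrow> (('h \<times> 'h) \<Rightarrow>\<^sub>L ('h \<times> 'h))"
  where "generator A = Jop o\<^sub>L imag_op o\<^sub>L A"

lemma Jop_generator: "Jop o\<^sub>L generator A = imag_op o\<^sub>L A"
  by (rule blinfun_eqI) (simp add: generator_def Jop_apply)

lemma clinear_op_generator: "clinear_op A \<Longrightarrow> clinear_op (generator A)"
  unfolding generator_def by (intro clinear_op_compose clinear_op_Jop clinear_op_imag_op)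

text \<open>\<open>Jop o\<^sub>L generator A\<close> is multiplication of \<open>A\<close> by
  \<open>\<i>\<close>, which is skew-adjoint because \<open>A\<close> is self-adjoint and commutes
  with \<open>\<i>\<close>.\<close>

lemma generator_skew:
  assumes "clinear_op A" "radj A = A"
  shows "radj (generator A) o\<^sub>L Jop = - (Jop o\<^sub>L generator A)"
proof (rule blinfun_eqI)
  fix x
  have "blinfun_apply A (\<i> *\<^sub>C x) = \<i> *\<^sub>C blinfun_apply A x"
    using assms(1) unfolding clinear_op_def by blast
  then show "blinfun_apply (radj (generator A) o\<^sub>L Jop) x = blinfun_apply (- (Jop o\<^sub>L generator A)) x"
    by (simp add: Jop_generator assms(2) radj_compose radj_Jop radj_imag_op generator_def
        blinfun.bilinear_simps imag_op_apply Jop_apply)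
qed

text \<open>The increment of \<open>G\<close> is the integral of \<open>G'\<close>, and a quadratic
  form passes through the integral. Nonnegativity of a complex number includes being real, so real
  and imaginary parts are integrated separately.\<close>

lemma has_vector_derivative_op_nonneg:
  fixes G :: "real \<Rightarrow> (('a::complex_inner) \<Rightarrow>\<^sub>L 'a)"
  assumes t: "0 \<le> t"
    and G: "\<And>s. s \<in> {0..t} \<Longrightarrow> (G has_vector_derivative G' s) (at s within {0..t})"
    and pos: "\<And>s. s \<in> {0..t} \<Longrightarrow> 0 \<le> - \<i> * cinner u (blinfun_apply (G' s) u)"
  shows "0 \<le> - \<i> * cinner u (blinfun_apply (G t - G 0) u)"
proof -
  have lin: "bounded_linear (\<lambda>A. - \<i> * cinner u (blinfun_apply A u))"
    by (intro bounded_linear_compose[OF bounded_linear_mult_right]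
        bounded_linear_compose[OF bounded_bilinear.bounded_linear_right[OF bounded_bilinear_cinner]]
        blinfun.bounded_linear_left)
  have int: "((\<lambda>s. - \<i> * cinner u (blinfun_apply (G' s) u)) has_integral
      - \<i> * cinner u (blinfun_apply (G t) u) - - \<i> * cinner u (blinfun_apply (G 0) u)) {0..t}"
    by (rule fundamental_theorem_of_calculus[OF t bounded_linear.has_vector_derivative[OF lin G]])
  define c where "c = - \<i> * cinner u (blinfun_apply (G t) u) - - \<i> * cinner u (blinfun_apply (G 0) u)"
  have "0 \<le> Re c"
    by (rule has_integral_nonneg[OF has_integral_linear[OF int bounded_linear_Re, folded c_def]])
      (use pos in \<open>simp add: less_eq_complex_def\<close>)
  moreover have "Im c = 0"
  proof (rule has_integral_unique)
    show "((\<lambda>s. Im (- \<i> * cinner u (blinfun_apply (G' s) u))) has_integral Im c) {0..t}"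
      using has_integral_linear[OF int bounded_linear_Im] by (simp add: c_def o_def)
    show "((\<lambda>s. Im (- \<i> * cinner u (blinfun_apply (G' s) u))) has_integral 0) {0..t}"
      by (rule has_integral_is_0) (use pos in \<open>simp add: less_eq_complex_def\<close>)
  qed
  ultimately have "0 \<le> c" by (simp add: less_eq_complex_def)
  then show ?thesis by (simp add: c_def blinfun.diff_left cinner_diff_right algebra_simps)
qed

theorem theorem6p1:
  fixes H P :: "real \<Rightarrow> (('h::chilbert_space \<times> 'h) \<Rightarrow>\<^sub>L ('h \<times> 'h))"
    and T :: "real \<Rightarrow> real \<Rightarrow> (('h \<times> 'h) \<Rightarrow>\<^sub>L ('h \<times> 'h))"
    and E t :: real
  assumes sep: "separable_space TYPE('h)"
    and H_sa: "\<And>s. clinear_op (H s) \<and> adj (H s) = H s"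
    and P_pos: "\<And>s. clinear_op (P s) \<and> op_nonneg (P s)"
    and H_lip: "\<exists>L. L-lipschitz_on {0..} H"
    and P_lip: "\<exists>L. L-lipschitz_on {0..} P"
    and ode: "\<And>e s. s \<ge> 0 \<Longrightarrow> \<exists>D. (T e has_vector_derivative D) (at s within {0..})
                  \<and> Jop o\<^sub>L D = imag_op o\<^sub>L (H s + e *\<^sub>R P s) o\<^sub>L T e s"
    and init: "\<And>e. J_unitary (T e 0) \<and> fredholm (T e 0 - id_blinfun)"
    and t_nonneg: "t \<ge> 0"
  shows "(op_pos (H t + E *\<^sub>R P t) \<longrightarrow>
            (\<exists>D. ((\<lambda>s. Vmap (T E s)) has_vector_derivative D) (at t within {0..})
                 \<and> op_pos ((- imag_op) o\<^sub>L adj (Vmap (T E t)) o\<^sub>L D)))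
       \<and> (op_neg (H t + E *\<^sub>R P t) \<longrightarrow>
            (\<exists>D. ((\<lambda>s. Vmap (T E s)) has_vector_derivative D) (at t within {0..})
                 \<and> op_neg ((- imag_op) o\<^sub>L adj (Vmap (T E t)) o\<^sub>L D)))
       \<and> (((\<lambda>e. T e 0) has_vector_derivative 0) (at E) \<longrightarrow>
            (\<exists>D. ((\<lambda>e. Vmap (T e t)) has_vector_derivative D) (at E)
                 \<and> op_nonneg ((- imag_op) o\<^sub>L adj (Vmap (T E t)) o\<^sub>L D)))"
proof -
  define A where "A e s = H s + e *\<^sub>R P s" for e s
  have P_sa: "radj (P s) = P s" and P_lin: "clinear_op (P s)" for s
    using P_pos op_nonneg_radj by auto
  have A_lin: "clinear_op (A e s)" for e s
    using H_sa P_lin unfolding A_def by (intro clinear_op_add clinear_op_scaleR) auto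
  have "radj (H s) = H s" for s using H_sa adj_eq_radj by metis
  then have A_sa: "radj (A e s) = A e s" for e s
    by (simp add: A_def P_sa linear_add[OF bounded_linear.linear[OF bounded_linear_radj]]
        linear_scale[OF bounded_linear.linear[OF bounded_linear_radj]])
  define L where "L e s = generator (A e s)" for e s
  have skew: "radj (L e s) o\<^sub>L Jop = - (Jop o\<^sub>L L e s)" for e s
    unfolding L_def by (rule generator_skew[OF A_lin A_sa])
  have JL: "blinfun_apply Jop (blinfun_apply (L e s) x) = \<i> *\<^sub>C blinfun_apply (A e s) x" for e s x
    using arg_cong[OF Jop_generator[of "A e s"], of "\<lambda>B. blinfun_apply B x"]
    by (simp add: L_def imag_op_apply)
  have LJ: "blinfun_apply (radj (L e s)) (blinfun_apply Jop x) = - (\<i> *\<^sub>C blinfun_apply (A e s) x)" for e s x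
    using arg_cong[OF skew[of e s], of "\<lambda>B. blinfun_apply B x"] by (simp add: blinfun.minus_left JL)
  have T: "(T e has_vector_derivative L e s o\<^sub>L T e s) (at s within {0..})" if s: "0 \<le> s" for e s
  proof -
    obtain D where D: "(T e has_vector_derivative D) (at s within {0..})"
      and JD: "Jop o\<^sub>L D = imag_op o\<^sub>L A e s o\<^sub>L T e s"
      using ode[OF s] unfolding A_def by blast
    have "D = L e s o\<^sub>L T e s"
    proof (rule blinfun_eqI)
      show "blinfun_apply D x = blinfun_apply (L e s o\<^sub>L T e s) x" for x
        using arg_cong[OF JD, of "\<lambda>B. blinfun_apply Jop (blinfun_apply B x)"]
        by (simp add: L_def generator_def) (simp add: Jop_apply)
    qed
    then show ?thesis using D by simp
  qed
  have T_Icc: "(T e has_vector_derivative L e s o\<^sub>L T e s) (at s within {0..r})" if "s \<in> {0..r}" for e s r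
    by (rule has_vector_derivative_within_subset[OF T]) (use that in auto)
  have T_cont: "continuous_on {0..r} (T e)" for e r
    using has_vector_derivative_continuous[OF T_Icc] by (simp add: continuous_on_eq_continuous_within)
  have HP_cont: "continuous_on {0..r} H" "continuous_on {0..r} P" for r
    using H_lip P_lip lipschitz_on_continuous_on
    by (meson continuous_on_subset atLeastAtMost_iff atLeast_iff subsetI)+
  have uni: "J_biunitary (T e s)" if s: "0 \<le> s" for e s
  proof -
    have "continuous_on {0..s} (L e)"
      unfolding L_def A_def generator_def by (intro continuous_intros HP_cont)
    then obtain K where K: "\<And>r. r \<in> {0..s} \<Longrightarrow> norm (L e r) \<le> K"
      by (rule continuous_on_Icc_norm_bounded) blast
    show ?thesis
    proof (rule J_biunitary_evolution[OF s T_Icc])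
      show "J_biunitary (T e 0)" using init J_unitary_imp_J_biunitary by blast
    qed (use K skew in \<open>auto simp: L_def intro!: clinear_op_generator A_lin\<close>)
  qed
  \<comment> \<open>Strictness in (i) and (ii) rests on this: the form at \<open>x\<close> is the
    form of \<open>A E t\<close> at \<open>T E t u\<close>, which must not be the zero
    vector.\<close>
  have T_neq_0: "blinfun_apply (T E t) u \<noteq> 0"
    if "(fst u, snd (blinfun_apply (T E t) u)) = x" "x \<noteq> 0" for u x
  proof
    assume Tu: "blinfun_apply (T E t) u = 0"
    then have "blinfun_apply Jop u = 0"
      using J_biunitary_apply(1)[OF uni[OF t_nonneg], of E u] by (simp add: Tu blinfun.zero_right)
    then have u: "u = 0" by (simp add: Jop_apply prod_eq_iff)
    have "x = 0" using that(1) unfolding Tu by (simp add: u zero_prod_def)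
    then show False using that(2) by simp
  qed

  obtain D where D: "((\<lambda>s. Vmap (T E s)) has_vector_derivative D) (at t within {0..})"
    and form: "\<And>u. cinner (fst u, snd (blinfun_apply (T E t) u))
         (blinfun_apply ((- imag_op) o\<^sub>L adj (Vmap (T E t)) o\<^sub>L D) (fst u, snd (blinfun_apply (T E t) u)))
       = - \<i> * cinner (blinfun_apply (T E t) u)
           (blinfun_apply Jop (blinfun_apply (L E t o\<^sub>L T E t) u))"
    by (rule Vmap_has_vector_derivative[of "{0..}" "T E" t, OF uni _ T]) (use t_nonneg in auto)
  have formA: "cinner x (blinfun_apply ((- imag_op) o\<^sub>L adj (Vmap (T E t)) o\<^sub>L D) x)
      = cinner (blinfun_apply (T E t) u) (blinfun_apply (A E t) (blinfun_apply (T E t) u))"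
    if "(fst u, snd (blinfun_apply (T E t) u)) = x" for u x
    using form[of u] unfolding that by (simp add: JL cinner_scaleC_right)
  note surj = scattering_coordinates_surj[OF uni[OF t_nonneg, of E]]
  have pos: "op_pos ((- imag_op) o\<^sub>L adj (Vmap (T E t)) o\<^sub>L D)" if "op_pos (A E t)"
    unfolding op_pos_def using that formA surj T_neq_0 unfolding op_pos_def by metis
  have neg: "op_neg ((- imag_op) o\<^sub>L adj (Vmap (T E t)) o\<^sub>L D)" if "op_neg (A E t)"
    unfolding op_neg_def using that formA surj T_neq_0 unfolding op_neg_def by metis

  have par: "\<exists>D. ((\<lambda>e. Vmap (T e t)) has_vector_derivative D) (at E)
                 \<and> op_nonneg ((- imag_op) o\<^sub>L adj (Vmap (T E t)) o\<^sub>L D)"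
    if init0: "((\<lambda>e. T e 0) has_vector_derivative 0) (at E)"
  proof -
    define Y where "Y e s = radj (T E s) o\<^sub>L Jop o\<^sub>L T e s" for e s
    \<comment> \<open>The derivative of \<open>Y e\<close> is \<open>e - E\<close> times
      \<open>radj (T E s) o\<^sub>L imag_op o\<^sub>L P s o\<^sub>L T e s\<close>. Writing
      \<open>T e s\<close> as \<open>T E s o\<^sub>L Jop o\<^sub>L Y e s\<close>, which uses the
      second J-identity, closes this into a linear equation for \<open>Y e\<close> with a
      coefficient independent of \<open>e\<close>.\<close>
    define B where "B s = radj (T E s) o\<^sub>L imag_op o\<^sub>L P s o\<^sub>L T E s o\<^sub>L Jop" for s
    have TY: "T e s = T E s o\<^sub>L Jop o\<^sub>L Y e s" if "0 \<le> s" for e s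
      by (rule blinfun_eqI)
        (simp add: Y_def J_biunitary_apply(2)[OF uni[OF that]], simp add: Jop_apply)
    have Y_deriv: "(Y e has_vector_derivative (e - E) *\<^sub>R (B s o\<^sub>L Y e s)) (at s within {0..t})"
      if s: "s \<in> {0..t}" for e s
    proof -
      have "(Y e has_vector_derivative ((radj (T E s) o\<^sub>L Jop) o\<^sub>L (L e s o\<^sub>L T e s)) +
          (((radj (T E s) o\<^sub>L 0) + (radj (L E s o\<^sub>L T E s) o\<^sub>L Jop)) o\<^sub>L T e s)) (at s within {0..t})"
        unfolding Y_def
        by (intro has_vector_derivative_blinfun_compose has_vector_derivative_radj T_Icc[OF s]
            has_vector_derivative_const)
      moreover have "((radj (T E s) o\<^sub>L Jop) o\<^sub>L (L e s o\<^sub>L T e s)) +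
          (((radj (T E s) o\<^sub>L 0) + (radj (L E s o\<^sub>L T E s) o\<^sub>L Jop)) o\<^sub>L T e s)
          = (e - E) *\<^sub>R (B s o\<^sub>L Y e s)"
      proof (rule blinfun_eqI)
        fix x
        define y where "y = blinfun_apply (T e s) x"
        have y: "blinfun_apply (T E s) (blinfun_apply Jop (blinfun_apply (Y e s) x)) = y"
          using s by (simp add: y_def TY[of s e])
        \<comment> \<open>\<open>H s\<close> cancels in the difference of the two energies; only
          \<open>P s\<close> remains.\<close>
        have "\<i> *\<^sub>C blinfun_apply (A e s) y - \<i> *\<^sub>C blinfun_apply (A E s) y
            = (e - E) *\<^sub>R (\<i> *\<^sub>C blinfun_apply (P s) y)"
          by (simp add: A_def blinfun.bilinear_simps scaleC_add_right scaleC_scaleR_commute scaleR_diff_left)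
        from arg_cong[OF this, of "blinfun_apply (radj (T E s))"]
        show "blinfun_apply (((radj (T E s) o\<^sub>L Jop) o\<^sub>L (L e s o\<^sub>L T e s)) +
          (((radj (T E s) o\<^sub>L 0) + (radj (L E s o\<^sub>L T E s) o\<^sub>L Jop)) o\<^sub>L T e s)) x
          = blinfun_apply ((e - E) *\<^sub>R (B s o\<^sub>L Y e s)) x"
          by (simp add: B_def y radj_compose JL LJ imag_op_apply blinfun.bilinear_simps
              flip: y_def)
      qed
      ultimately show ?thesis by simp
    qed
    have radj_cont: "continuous_on {0..t} (\<lambda>s. radj (T E s))"
      by (rule bounded_linear.continuous_on[OF bounded_linear_radj T_cont])
    have B_cont: "continuous_on {0..t} B"
      unfolding B_def by (intro continuous_intros radj_cont HP_cont T_cont)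
    then obtain K where K: "\<And>s. s \<in> {0..t} \<Longrightarrow> norm (B s) \<le> K"
      by (rule continuous_on_Icc_norm_bounded) blast
    have "continuous_on {0..t} (\<lambda>s. B s o\<^sub>L Y E 0)"
      by (intro continuous_intros B_cont)
    then obtain G where G: "\<And>s. s \<in> {0..t} \<Longrightarrow> (G has_vector_derivative B s o\<^sub>L Y E 0) (at s within {0..t})"
      using antiderivative_continuous by blast
    have Y0: "((\<lambda>e. Y e 0) has_vector_derivative 0) (at E)"
      using has_vector_derivative_blinfun_compose[OF has_vector_derivative_const init0,
          of "radj (T E 0) o\<^sub>L Jop"]
      by (simp add: Y_def)
    note Yt = has_vector_derivative_parameter[OF t_nonneg Y_deriv K G Y0]
    \<comment> \<open>The prefactor \<open>T E t o\<^sub>L Jop\<close> does not vary with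
      \<open>e\<close>, so differentiability of \<open>T e t\<close> in the energy reduces to that
      of \<open>Y e t\<close>.\<close>
    have "((\<lambda>e. T e t) has_vector_derivative T E t o\<^sub>L Jop o\<^sub>L (G t - G 0)) (at E)"
      using has_vector_derivative_blinfun_compose[OF has_vector_derivative_const Yt,
          of "T E t o\<^sub>L Jop"]
      by (simp add: TY[OF t_nonneg, symmetric])
    then obtain D' where D': "((\<lambda>e. Vmap (T e t)) has_vector_derivative D') (at E)"
      and form': "\<And>u. cinner (fst u, snd (blinfun_apply (T E t) u))
         (blinfun_apply ((- imag_op) o\<^sub>L adj (Vmap (T E t)) o\<^sub>L D') (fst u, snd (blinfun_apply (T E t) u)))
       = - \<i> * cinner (blinfun_apply (T E t) u)
           (blinfun_apply Jop (blinfun_apply (T E t o\<^sub>L Jop o\<^sub>L (G t - G 0)) u))"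
      by (rule Vmap_has_vector_derivative[of UNIV "\<lambda>e. T e t" E, OF uni[OF t_nonneg] UNIV_I]) auto
    have "0 \<le> cinner x (blinfun_apply ((- imag_op) o\<^sub>L adj (Vmap (T E t)) o\<^sub>L D') x)" for x
    proof -
      obtain u where u: "(fst u, snd (blinfun_apply (T E t) u)) = x" using surj by metis
      have "0 \<le> - \<i> * cinner u (blinfun_apply (B s o\<^sub>L Y E 0) u)" if s: "s \<in> {0..t}" for s
      proof -
        let ?v = "blinfun_apply (T E s) u"
        have lin: "clinear_op (T E s)" using uni s by (simp add: J_biunitary_def)
        \<comment> \<open>\<open>Y E 0\<close> equals \<open>Jop\<close> and cancels the trailing
          \<open>Jop\<close> in \<open>B s\<close>, leaving the manifestly nonnegative form of
          \<open>P s\<close> at \<open>T E s u\<close> times \<open>\<i>\<close>.\<close>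
        have "blinfun_apply (Y E 0) u = blinfun_apply Jop u"
          by (simp add: Y_def J_biunitary_apply(1)[OF uni])
        then have "blinfun_apply (B s o\<^sub>L Y E 0) u
            = blinfun_apply (radj (T E s)) (\<i> *\<^sub>C blinfun_apply (P s) ?v)"
          by (simp add: B_def imag_op_apply) (simp add: Jop_apply)
        then have "- \<i> * cinner u (blinfun_apply (B s o\<^sub>L Y E 0) u) = cinner ?v (blinfun_apply (P s) ?v)"
          by (simp add: cinner_radj[OF lin, symmetric] cinner_scaleC_right)
        moreover have "0 \<le> cinner ?v (blinfun_apply (P s) ?v)"
          using P_pos unfolding op_nonneg_def by blast
        ultimately show ?thesis by simp
      qed
      from has_vector_derivative_op_nonneg[OF t_nonneg G this]
      have "0 \<le> - \<i> * cinner u (blinfun_apply (G t - G 0) u)" .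
      \<comment> \<open>J-unitarity of \<open>T E t\<close> removes \<open>T E t\<close> from both
        sides of the form, and the two remaining factors \<open>Jop\<close> cancel.\<close>
      also have "cinner u (blinfun_apply (G t - G 0) u)
          = cinner (blinfun_apply (T E t) u)
           (blinfun_apply Jop (blinfun_apply (T E t o\<^sub>L Jop o\<^sub>L (G t - G 0)) u))"
        by (simp add: J_biunitary_cinner[OF uni[OF t_nonneg]]) (simp add: Jop_apply)
      finally show ?thesis using form'[of u] unfolding u by simp
    qed
    then show ?thesis using D' by (auto simp: op_nonneg_def)
  qed
  show ?thesis using D pos neg par unfolding A_def by blast
qed

end
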